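(* Let $(\phi_1,\phi_2,\phi_3)$ be an integrable almost bi-paracontact structure on the contact manifold $(M,\eta)$ such that the associated canonical connection $\nabla^c$ satisfies $\nabla^cd\eta=0$ and $$\nabla^c\phi_1=-a\,\eta\otimes\phi_2,\qquad \nabla^c\phi_2=a\,\eta\otimes\phi_1+b\,\eta\otimes\phi_3,\qquad \nabla^c\phi_3=b\,\eta\otimes\phi_2$$ for some constants $a>0$ (respectively, $a<0$) and $b>0$. Define $$g_1:=d\eta(\cdot,\phi_1\cdot)+\eta\otimes\eta,\quad g_2:=d\eta(\cdot,\phi_2\cdot)+\eta\otimes\eta,\quad g_3:=-d\eta(\cdot,\phi_3\cdot)+\eta\otimes\eta$$ and assume that the symmetric bilinear form $\pi_1:=g_1(h_1\cdot,\cdot)$ is positive definite (respectively, negative definite) on the contact distribution $\mathcal D$. Then, for each $\alpha\in\{1,2\}$, $(\phi_\alpha,\xi,\eta,g_\alpha)$ is a paracontact metric $(\kappa_\alpha,\mu_\alpha)$-structure and $(\phi_3,\xi,\eta,g_3)$ is a contact metric $(\kappa_3,\mu_3)$-structure, where $$\kappa_1=\tfrac94a^2-1,\ \mu_1=2-3b,\qquad \kappa_2=\tfrac94(a^2-b^2)-1,\ \mu_2=2,\qquad \kappa_3=1-\tfrac94b^2,\ \mu_3=2-3a.$$ Moreover, $(\phi_1,\phi_2,\phi_3)$ is the standard almost bi-paracontact structure of the contact metric $(\kappa_3,\mu_3)$-manifold $(M,\phi_3,\xi,\eta,g_3)$.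
   Context: Everything is smooth. A contact manifold $(M,\eta)$ is a $(2n+1)$-dimensional manifold with a $1$-form $\eta$ such that $\eta\wedge(d\eta)^n\neq 0$ everywhere; its Reeb vector field $\xi$ is determined by $\eta(\xi)=1$, $d\eta(\xi,\cdot)=0$; $\mathcal D=\ker\eta$. Normalization: $2d\eta(X,Y)=X(\eta(Y))-Y(\eta(X))-\eta([X,Y])$. An almost bi-paracontact structure on $(M,\eta)$ is a triplet $(\phi_1,\phi_2,\phi_3)$ of $(1,1)$-tensor fields with $\phi_1\phi_2=-\phi_2\phi_1$, $\phi_1^2=\phi_2^2=I-\eta\otimes\xi$, $\phi_3=\phi_1\phi_2$, $\phi_3^2=-I+\eta\otimes\xi$. It is integrable if the $\pm1$-eigendistributions of $\phi_1$ and of $\phi_2$ are Legendre foliations (involutive rank $n$ subbundles of $\mathcal D$). $h_\alpha:=\frac12\mathcal L_\xi\phi_\alpha$, $\alpha=1,2,3$. With $[\phi,\phi](X,Y)=\phi^2[X,Y]+[\phi X,\phi Y]-\phi[\phi X,Y]-\phi[X,\phi Y]$, $N^{(1)}_{\phi_\alpha}=[\phi_\alpha,\phi_\alpha]-2d\eta\otimes\xi$ for $\alpha=1,2$ and $N^{(1)}_{\phi_3}=[\phi_3,\phi_3]+2d\eta\otimes\xi$. $\nabla\phi=\eta\otimes B$ means $(\nabla_X\phi)Y=\eta(X)BY$. The canonical connection $\nabla^c$ of an almost bi-paracontact manifold is the unique linear connection with $\nabla^c\xi=0$, $\nabla^c\phi_\alpha=\frac23\eta\otimes h_\alpha$ ($\alpha=1,2,3$)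 and torsion $T^c(X,Y)=d\eta(X,Y)\xi+\frac13(-d\eta(\phi_1X,\phi_1Y)-d\eta(\phi_2X,\phi_2Y)+d\eta(\phi_3X,\phi_3Y))\xi+\frac16(-N^{(1)}_{\phi_1}-N^{(1)}_{\phi_2}+N^{(1)}_{\phi_3})(X,Y)$. A paracontact metric structure $(\tilde\phi,\xi,\eta,\tilde g)$: $\eta(\xi)=1$, $\tilde\phi^2=I-\eta\otimes\xi$, the $\pm1$-eigendistributions of $\tilde\phi$ on $\mathcal D$ have rank $n$, and $\tilde g$ is a semi-Riemannian metric with $\tilde g(\tilde\phi X,\tilde\phi Y)=-\tilde g(X,Y)+\eta(X)\eta(Y)$, $d\eta(X,Y)=\tilde g(X,\tilde\phi Y)$. A contact metric structure $(\phi,\xi,\eta,g)$: $\phi^2=-I+\eta\otimes\xi$, $\eta(\xi)=1$, $g$ Riemannian with $g(\phi X,\phi Y)=g(X,Y)-\eta(X)\eta(Y)$, $d\eta(X,Y)=g(X,\phi Y)$. Such a (para)contact metric structure with tensor $\psi$ and metric $g$ is a (para)contact metric $(\kappa,\mu)$-structure if $R^g(X,Y)\xi=\kappa(\eta(Y)X-\eta(X)Y)+\mu(\eta(Y)hX-\eta(X)hY)$ for all $X,Y$, where $h=\frac12\mathcal L_\xi\psi$ and $R^g(X,Y)=[\nabla^g_X,\nabla^g_Y]-\nabla^g_{[X,Y]}$ is the Levi-Civita curvature. The standard almost bi-paracontact structure of a contact metric $(\kappa,\mu)$-manifold $(M,\phi,\xi,\eta,g)$ with $\kappa<1$ is $\bigl(\frac1{\sqrt{1-\kappa}}\phi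 h,\frac1{\sqrt{1-\kappa}}h,\phi\bigr)$, $h=\frac12\mathcal L_\xi\phi$. *)

theory Defs
  imports
    "HOL-Analysis.Analysis"
    "HOL-Library.Function_Algebras"
    "HOL-Combinatorics.Permutations"
begin

subsection \<open>Smooth manifolds\<close>

fun Ck_on :: "nat \<Rightarrow> 'e::euclidean_space set \<Rightarrow> ('e \<Rightarrow> 'f::real_normed_vector) \<Rightarrow> bool" where
  "Ck_on 0 S f \<longleftrightarrow> continuous_on S f"
| "Ck_on (Suc k) S f \<longleftrightarrow>
    (\<forall>x\<in>S. f differentiable (at x)) \<and> (\<forall>v. Ck_on k S (\<lambda>x. frechet_derivative f (at x) v))"

text \<open>Only used for open sets \<open>S\<close>.\<close>

definition smooth_on :: "'e::euclidean_space set \<Rightarrow> ('e \<Rightarrow> 'f::real_normed_vector) \<Rightarrow> bool" where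
  "smooth_on S f \<longleftrightarrow> (\<forall>k. Ck_on k S f)"

type_synonym ('a, 'e) atlas = "('a set \<times> ('a \<Rightarrow> 'e)) set"

text \<open>The carrier of the manifold is the whole type \<open>'a\<close>, its dimension is \<open>DIM('e)\<close>.
  The values of a chart outside its domain are irrelevant.\<close>

definition smooth_atlas ::
  "('a::{t2_space,second_countable_topology}, 'e::euclidean_space) atlas \<Rightarrow> bool" where
  "smooth_atlas A \<longleftrightarrow>
    (\<Union>(U, c)\<in>A. U) = UNIV \<and>
    (\<forall>(U, c)\<in>A. open U \<and> open (c ` U) \<and> homeomorphism U (c ` U) c (inv_into U c)) \<and>
    (\<forall>(U, c)\<in>A. \<forall>(V, d)\<in>A. smooth_on (c ` (U \<inter> V)) (d \<circ> inv_into U c))"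

definition smooth_functions :: "('a, 'e::euclidean_space) atlas \<Rightarrow> ('a \<Rightarrow> real) set" where
  "smooth_functions A = {f. \<forall>(U, c)\<in>A. smooth_on (c ` U) (f \<circ> inv_into U c)}"

subsection \<open>Vector fields and tensor fields\<close>

text \<open>Vector fields are the derivations of the algebra of smooth functions. They are set to zero
  on non-smooth functions, so that equality of vector fields is equality of HOL functions.
  Tensor fields are the maps on vector fields that are multilinear over the smooth functions;
  their values on arguments that are not vector fields are irrelevant.\<close>

type_synonym 'a vfield = "('a \<Rightarrow> real) \<Rightarrow> ('a \<Rightarrow> real)"

definition vector_fields :: "('a, 'e::euclidean_space) atlas \<Rightarrow> 'a vfield set" where
  "vector_fields A = {X.
    (\<forall>f\<in>smooth_functions A. X f \<in> smooth_functions A) \<and>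
    (\<forall>f\<in>smooth_functions A. \<forall>g\<in>smooth_functions A. X (f + g) = X f + X g) \<and>
    (\<forall>f\<in>smooth_functions A. \<forall>r::real. X ((\<lambda>_. r) * f) = (\<lambda>_. r) * X f) \<and>
    (\<forall>f\<in>smooth_functions A. \<forall>g\<in>smooth_functions A. X (f * g) = X f * g + f * X g) \<and>
    (\<forall>f. f \<notin> smooth_functions A \<longrightarrow> X f = 0)}"

definition fscale :: "('a \<Rightarrow> real) \<Rightarrow> 'a vfield \<Rightarrow> 'a vfield" (infixr "\<odot>" 75) where
  "u \<odot> X = (\<lambda>f. u * X f)"

definition cscale :: "real \<Rightarrow> 'a vfield \<Rightarrow> 'a vfield" (infixr "\<cdot>" 75) where
  "r \<cdot> X = (\<lambda>_. r) \<odot> X"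

definition lie_bracket :: "'a vfield \<Rightarrow> 'a vfield \<Rightarrow> 'a vfield" where
  "lie_bracket X Y = (\<lambda>f. X (Y f) - Y (X f))"

text \<open>The tangent vector at \<open>p\<close> given by a vector field.\<close>

definition value_at :: "'a \<Rightarrow> 'a vfield \<Rightarrow> (('a \<Rightarrow> real) \<Rightarrow> real)" where
  "value_at p X = (\<lambda>f. X f p)"

definition one_form :: "('a, 'e::euclidean_space) atlas \<Rightarrow> ('a vfield \<Rightarrow> 'a \<Rightarrow> real) \<Rightarrow> bool" where
  "one_form A \<omega> \<longleftrightarrow>
    (\<forall>X\<in>vector_fields A. \<omega> X \<in> smooth_functions A) \<and>
    (\<forall>X\<in>vector_fields A. \<forall>Y\<in>vector_fields A. \<omega> (X + Y) = \<omega> X + \<omega> Y) \<and>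
    (\<forall>u\<in>smooth_functions A. \<forall>X\<in>vector_fields A. \<omega> (u \<odot> X) = u * \<omega> X)"

definition tensor_11 :: "('a, 'e::euclidean_space) atlas \<Rightarrow> ('a vfield \<Rightarrow> 'a vfield) \<Rightarrow> bool" where
  "tensor_11 A \<phi> \<longleftrightarrow>
    (\<forall>X\<in>vector_fields A. \<phi> X \<in> vector_fields A) \<and>
    (\<forall>X\<in>vector_fields A. \<forall>Y\<in>vector_fields A. \<phi> (X + Y) = \<phi> X + \<phi> Y) \<and>
    (\<forall>u\<in>smooth_functions A. \<forall>X\<in>vector_fields A. \<phi> (u \<odot> X) = u \<odot> \<phi> X)"

definition tensor_02 ::
  "('a, 'e::euclidean_space) atlas \<Rightarrow> ('a vfield \<Rightarrow> 'a vfield \<Rightarrow> 'a \<Rightarrow> real) \<Rightarrow> bool" where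
  "tensor_02 A g \<longleftrightarrow>
    (\<forall>X\<in>vector_fields A. one_form A (g X)) \<and>
    (\<forall>Y\<in>vector_fields A. one_form A (\<lambda>X. g X Y))"

text \<open>Exterior derivative of a 1-form, in the normalization
  \<open>2 d\<eta>(X,Y) = X(\<eta>(Y)) - Y(\<eta>(X)) - \<eta>([X,Y])\<close>.\<close>

definition ext_deriv :: "('a vfield \<Rightarrow> 'a \<Rightarrow> real) \<Rightarrow> 'a vfield \<Rightarrow> 'a vfield \<Rightarrow> 'a \<Rightarrow> real" where
  "ext_deriv \<eta> X Y = (\<lambda>p. (X (\<eta> Y) p - Y (\<eta> X) p - \<eta> (lie_bracket X Y) p) / 2)"

text \<open>Wedge product of a \<open>k\<close>-form and an \<open>l\<close>-form. A form of degree \<open>k\<close> takes the family of its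
  arguments, of which only those with index below \<open>k\<close> are used. The factor \<open>1 / (k + l)!\<close> is the one
  that goes with the above normalization of the exterior derivative.\<close>

definition wedge ::
  "nat \<Rightarrow> nat \<Rightarrow> ((nat \<Rightarrow> 'v) \<Rightarrow> 'a \<Rightarrow> real) \<Rightarrow> ((nat \<Rightarrow> 'v) \<Rightarrow> 'a \<Rightarrow> real) \<Rightarrow> (nat \<Rightarrow> 'v) \<Rightarrow> 'a \<Rightarrow> real" where
  "wedge k l \<alpha> \<beta> X = (\<lambda>p. (\<Sum>\<sigma> | \<sigma> permutes {..<k + l}.
      of_int (sign \<sigma>) * \<alpha> (\<lambda>i. X (\<sigma> i)) p * \<beta> (\<lambda>i. X (\<sigma> (k + i))) p) / fact (k + l))"

primrec wedge_power2 :: "((nat \<Rightarrow> 'v) \<Rightarrow> 'a \<Rightarrow> real) \<Rightarrow> nat \<Rightarrow> (nat \<Rightarrow> 'v) \<Rightarrow> 'a \<Rightarrow> real" where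
  "wedge_power2 \<omega> 0 = (\<lambda>_ _. 1)"
| "wedge_power2 \<omega> (Suc m) = wedge 2 (2 * m) \<omega> (wedge_power2 \<omega> m)"

subsection \<open>Contact manifolds\<close>

definition contact_manifold ::
  "('a::{t2_space,second_countable_topology}, 'e::euclidean_space) atlas \<Rightarrow> nat \<Rightarrow>
    ('a vfield \<Rightarrow> 'a \<Rightarrow> real) \<Rightarrow> bool" where
  "contact_manifold A n \<eta> \<longleftrightarrow>
    smooth_atlas A \<and> DIM('e) = 2 * n + 1 \<and> one_form A \<eta> \<and>
    (\<forall>p. \<exists>X. (\<forall>i<2 * n + 1. X i \<in> vector_fields A) \<and>
      wedge 1 (2 * n) (\<lambda>X. \<eta> (X 0)) (wedge_power2 (\<lambda>X. ext_deriv \<eta> (X 0) (X 1)) n) X p \<noteq> 0)"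

definition reeb_field ::
  "('a, 'e::euclidean_space) atlas \<Rightarrow> ('a vfield \<Rightarrow> 'a \<Rightarrow> real) \<Rightarrow> 'a vfield \<Rightarrow> bool" where
  "reeb_field A \<eta> \<xi> \<longleftrightarrow>
    \<xi> \<in> vector_fields A \<and> \<eta> \<xi> = 1 \<and> (\<forall>X\<in>vector_fields A. ext_deriv \<eta> \<xi> X = 0)"

text \<open>Distributions are represented by their modules of (global) sections.\<close>

definition contact_distribution ::
  "('a, 'e::euclidean_space) atlas \<Rightarrow> ('a vfield \<Rightarrow> 'a \<Rightarrow> real) \<Rightarrow> 'a vfield set" where
  "contact_distribution A \<eta> = {X\<in>vector_fields A. \<eta> X = 0}"

definition eigendistribution ::
  "('a, 'e::euclidean_space) atlas \<Rightarrow> ('a vfield \<Rightarrow> 'a vfield) \<Rightarrow> real \<Rightarrow> 'a vfield set" where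
  "eigendistribution A \<phi> r = {X\<in>vector_fields A. \<phi> X = r \<cdot> X}"

definition has_rank :: "'a vfield set \<Rightarrow> nat \<Rightarrow> bool" where
  "has_rank E n \<longleftrightarrow>
    (\<forall>p. vector_space.dim (\<lambda>(r::real) (v::('a \<Rightarrow> real) \<Rightarrow> real). \<lambda>f. r * v f) (value_at p ` E) = n)"

definition legendre_foliation ::
  "('a, 'e::euclidean_space) atlas \<Rightarrow> nat \<Rightarrow> ('a vfield \<Rightarrow> 'a \<Rightarrow> real) \<Rightarrow> 'a vfield set \<Rightarrow> bool" where
  "legendre_foliation A n \<eta> E \<longleftrightarrow>
    E \<subseteq> contact_distribution A \<eta> \<and> has_rank E n \<and> (\<forall>X\<in>E. \<forall>Y\<in>E. lie_bracket X Y \<in> E)"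

text \<open>The tensor \<open>h = (1/2) L\<^sub>\<xi> \<phi>\<close>.\<close>

definition half_lie :: "'a vfield \<Rightarrow> ('a vfield \<Rightarrow> 'a vfield) \<Rightarrow> 'a vfield \<Rightarrow> 'a vfield" where
  "half_lie \<xi> \<phi> X = (1/2) \<cdot> (lie_bracket \<xi> (\<phi> X) - \<phi> (lie_bracket \<xi> X))"

subsection \<open>Linear connections\<close>

definition linear_connection ::
  "('a, 'e::euclidean_space) atlas \<Rightarrow> ('a vfield \<Rightarrow> 'a vfield \<Rightarrow> 'a vfield) \<Rightarrow> bool" where
  "linear_connection A D \<longleftrightarrow>
    (\<forall>X\<in>vector_fields A. \<forall>Y\<in>vector_fields A. D X Y \<in> vector_fields A) \<and>
    (\<forall>X\<in>vector_fields A. \<forall>Y\<in>vector_fields A. \<forall>Z\<in>vector_fields A.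
      D (X + Y) Z = D X Z + D Y Z \<and> D X (Y + Z) = D X Y + D X Z) \<and>
    (\<forall>u\<in>smooth_functions A. \<forall>X\<in>vector_fields A. \<forall>Y\<in>vector_fields A.
      D (u \<odot> X) Y = u \<odot> D X Y \<and> D X (u \<odot> Y) = X u \<odot> Y + u \<odot> D X Y)"

definition cov_deriv_11 ::
  "('a vfield \<Rightarrow> 'a vfield \<Rightarrow> 'a vfield) \<Rightarrow> ('a vfield \<Rightarrow> 'a vfield) \<Rightarrow>
    'a vfield \<Rightarrow> 'a vfield \<Rightarrow> 'a vfield" where
  "cov_deriv_11 D \<phi> X Y = D X (\<phi> Y) - \<phi> (D X Y)"

definition cov_deriv_02 ::
  "('a vfield \<Rightarrow> 'a vfield \<Rightarrow> 'a vfield) \<Rightarrow> ('a vfield \<Rightarrow> 'a vfield \<Rightarrow> 'a \<Rightarrow> real) \<Rightarrow>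
    'a vfield \<Rightarrow> 'a vfield \<Rightarrow> 'a vfield \<Rightarrow> 'a \<Rightarrow> real" where
  "cov_deriv_02 D g X Y Z = X (g Y Z) - g (D X Y) Z - g Y (D X Z)"

text \<open>\<open>\<nabla>\<phi> = \<eta> \<otimes> B\<close>.\<close>

definition cov_deriv_eq ::
  "('a, 'e::euclidean_space) atlas \<Rightarrow> ('a vfield \<Rightarrow> 'a \<Rightarrow> real) \<Rightarrow>
    ('a vfield \<Rightarrow> 'a vfield \<Rightarrow> 'a vfield) \<Rightarrow> ('a vfield \<Rightarrow> 'a vfield) \<Rightarrow> ('a vfield \<Rightarrow> 'a vfield) \<Rightarrow> bool" where
  "cov_deriv_eq A \<eta> D \<phi> B \<longleftrightarrow>
    (\<forall>X\<in>vector_fields A. \<forall>Y\<in>vector_fields A. cov_deriv_11 D \<phi> X Y = \<eta> X \<odot> B Y)"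

definition torsion ::
  "('a vfield \<Rightarrow> 'a vfield \<Rightarrow> 'a vfield) \<Rightarrow> 'a vfield \<Rightarrow> 'a vfield \<Rightarrow> 'a vfield" where
  "torsion D X Y = D X Y - D Y X - lie_bracket X Y"

definition curvature ::
  "('a vfield \<Rightarrow> 'a vfield \<Rightarrow> 'a vfield) \<Rightarrow> 'a vfield \<Rightarrow> 'a vfield \<Rightarrow> 'a vfield \<Rightarrow> 'a vfield" where
  "curvature D X Y Z = D X (D Y Z) - D Y (D X Z) - D (lie_bracket X Y) Z"

subsection \<open>Almost bi-paracontact structures\<close>

definition almost_bi_paracontact ::
  "('a, 'e::euclidean_space) atlas \<Rightarrow> ('a vfield \<Rightarrow> 'a \<Rightarrow> real) \<Rightarrow> 'a vfield \<Rightarrow>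
    ('a vfield \<Rightarrow> 'a vfield) \<Rightarrow> ('a vfield \<Rightarrow> 'a vfield) \<Rightarrow> ('a vfield \<Rightarrow> 'a vfield) \<Rightarrow> bool" where
  "almost_bi_paracontact A \<eta> \<xi> \<phi>\<^sub>1 \<phi>\<^sub>2 \<phi>\<^sub>3 \<longleftrightarrow>
    tensor_11 A \<phi>\<^sub>1 \<and> tensor_11 A \<phi>\<^sub>2 \<and> tensor_11 A \<phi>\<^sub>3 \<and>
    (\<forall>X\<in>vector_fields A.
      \<phi>\<^sub>1 (\<phi>\<^sub>2 X) = - \<phi>\<^sub>2 (\<phi>\<^sub>1 X) \<and>
      \<phi>\<^sub>1 (\<phi>\<^sub>1 X) = X - \<eta> X \<odot> \<xi> \<and>
      \<phi>\<^sub>2 (\<phi>\<^sub>2 X) = X - \<eta> X \<odot> \<xi> \<and>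
      \<phi>\<^sub>3 X = \<phi>\<^sub>1 (\<phi>\<^sub>2 X) \<and>
      \<phi>\<^sub>3 (\<phi>\<^sub>3 X) = - X + \<eta> X \<odot> \<xi>)"

definition integrable_almost_bi_paracontact ::
  "('a, 'e::euclidean_space) atlas \<Rightarrow> nat \<Rightarrow> ('a vfield \<Rightarrow> 'a \<Rightarrow> real) \<Rightarrow> 'a vfield \<Rightarrow>
    ('a vfield \<Rightarrow> 'a vfield) \<Rightarrow> ('a vfield \<Rightarrow> 'a vfield) \<Rightarrow> ('a vfield \<Rightarrow> 'a vfield) \<Rightarrow> bool" where
  "integrable_almost_bi_paracontact A n \<eta> \<xi> \<phi>\<^sub>1 \<phi>\<^sub>2 \<phi>\<^sub>3 \<longleftrightarrow>
    almost_bi_paracontact A \<eta> \<xi> \<phi>\<^sub>1 \<phi>\<^sub>2 \<phi>\<^sub>3 \<and>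
    (\<forall>\<phi>\<in>{\<phi>\<^sub>1, \<phi>\<^sub>2}. \<forall>r\<in>{1, -1}. legendre_foliation A n \<eta> (eigendistribution A \<phi> r))"

definition nijenhuis :: "('a vfield \<Rightarrow> 'a vfield) \<Rightarrow> 'a vfield \<Rightarrow> 'a vfield \<Rightarrow> 'a vfield" where
  "nijenhuis \<phi> X Y = \<phi> (\<phi> (lie_bracket X Y)) + lie_bracket (\<phi> X) (\<phi> Y)
    - \<phi> (lie_bracket (\<phi> X) Y) - \<phi> (lie_bracket X (\<phi> Y))"

text \<open>\<open>N\<^sup>(\<^sup>1\<^sup>)\<close> for a tensor with \<open>\<phi>\<^sup>2 = \<epsilon> (I - \<eta> \<otimes> \<xi>)\<close>.\<close>

definition N1 ::
  "real \<Rightarrow> ('a vfield \<Rightarrow> 'a \<Rightarrow> real) \<Rightarrow> 'a vfield \<Rightarrow> ('a vfield \<Rightarrow> 'a vfield) \<Rightarrow>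
    'a vfield \<Rightarrow> 'a vfield \<Rightarrow> 'a vfield" where
  "N1 \<epsilon> \<eta> \<xi> \<phi> X Y = nijenhuis \<phi> X Y - (2 * \<epsilon>) \<cdot> ext_deriv \<eta> X Y \<odot> \<xi>"

definition canonical_connection ::
  "('a, 'e::euclidean_space) atlas \<Rightarrow> ('a vfield \<Rightarrow> 'a \<Rightarrow> real) \<Rightarrow> 'a vfield \<Rightarrow>
    ('a vfield \<Rightarrow> 'a vfield) \<Rightarrow> ('a vfield \<Rightarrow> 'a vfield) \<Rightarrow> ('a vfield \<Rightarrow> 'a vfield) \<Rightarrow>
    ('a vfield \<Rightarrow> 'a vfield \<Rightarrow> 'a vfield) \<Rightarrow> bool" where
  "canonical_connection A \<eta> \<xi> \<phi>\<^sub>1 \<phi>\<^sub>2 \<phi>\<^sub>3 D \<longleftrightarrow>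
    linear_connection A D \<and>
    (\<forall>X\<in>vector_fields A. D X \<xi> = 0) \<and>
    (\<forall>\<phi>\<in>{\<phi>\<^sub>1, \<phi>\<^sub>2, \<phi>\<^sub>3}. cov_deriv_eq A \<eta> D \<phi> (\<lambda>Y. (2/3) \<cdot> half_lie \<xi> \<phi> Y)) \<and>
    (\<forall>X\<in>vector_fields A. \<forall>Y\<in>vector_fields A.
      torsion D X Y = ext_deriv \<eta> X Y \<odot> \<xi>
        + (1/3) \<cdot> (- ext_deriv \<eta> (\<phi>\<^sub>1 X) (\<phi>\<^sub>1 Y) - ext_deriv \<eta> (\<phi>\<^sub>2 X) (\<phi>\<^sub>2 Y)
            + ext_deriv \<eta> (\<phi>\<^sub>3 X) (\<phi>\<^sub>3 Y)) \<odot> \<xi>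
        + (1/6) \<cdot> (- N1 1 \<eta> \<xi> \<phi>\<^sub>1 X Y - N1 1 \<eta> \<xi> \<phi>\<^sub>2 X Y + N1 (-1) \<eta> \<xi> \<phi>\<^sub>3 X Y))"

subsection \<open>Metric structures\<close>

text \<open>Definiteness on the distribution with module of sections \<open>E\<close>. Every vector of the
  distribution is the value of a section.\<close>

definition positive_definite_on ::
  "'a vfield set \<Rightarrow> ('a vfield \<Rightarrow> 'a vfield \<Rightarrow> 'a \<Rightarrow> real) \<Rightarrow> bool" where
  "positive_definite_on E g \<longleftrightarrow> (\<forall>X\<in>E. \<forall>p. value_at p X \<noteq> 0 \<longrightarrow> g X X p > 0)"

definition negative_definite_on ::
  "'a vfield set \<Rightarrow> ('a vfield \<Rightarrow> 'a vfield \<Rightarrow> 'a \<Rightarrow> real) \<Rightarrow> bool" where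
  "negative_definite_on E g \<longleftrightarrow> (\<forall>X\<in>E. \<forall>p. value_at p X \<noteq> 0 \<longrightarrow> g X X p < 0)"

definition symmetric_tensor ::
  "('a, 'e::euclidean_space) atlas \<Rightarrow> ('a vfield \<Rightarrow> 'a vfield \<Rightarrow> 'a \<Rightarrow> real) \<Rightarrow> bool" where
  "symmetric_tensor A g \<longleftrightarrow>
    tensor_02 A g \<and> (\<forall>X\<in>vector_fields A. \<forall>Y\<in>vector_fields A. g X Y = g Y X)"

definition semi_riemannian_metric ::
  "('a, 'e::euclidean_space) atlas \<Rightarrow> ('a vfield \<Rightarrow> 'a vfield \<Rightarrow> 'a \<Rightarrow> real) \<Rightarrow> bool" where
  "semi_riemannian_metric A g \<longleftrightarrow>
    symmetric_tensor A g \<and>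
    (\<forall>p. \<forall>X\<in>vector_fields A. (\<forall>Y\<in>vector_fields A. g X Y p = 0) \<longrightarrow> value_at p X = 0)"

definition riemannian_metric ::
  "('a, 'e::euclidean_space) atlas \<Rightarrow> ('a vfield \<Rightarrow> 'a vfield \<Rightarrow> 'a \<Rightarrow> real) \<Rightarrow> bool" where
  "riemannian_metric A g \<longleftrightarrow>
    symmetric_tensor A g \<and> positive_definite_on (vector_fields A) g"

definition levi_civita_connection ::
  "('a, 'e::euclidean_space) atlas \<Rightarrow> ('a vfield \<Rightarrow> 'a vfield \<Rightarrow> 'a \<Rightarrow> real) \<Rightarrow>
    ('a vfield \<Rightarrow> 'a vfield \<Rightarrow> 'a vfield) \<Rightarrow> bool" where
  "levi_civita_connection A g D \<longleftrightarrow>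
    linear_connection A D \<and>
    (\<forall>X\<in>vector_fields A. \<forall>Y\<in>vector_fields A. torsion D X Y = 0) \<and>
    (\<forall>X\<in>vector_fields A. \<forall>Y\<in>vector_fields A. \<forall>Z\<in>vector_fields A. cov_deriv_02 D g X Y Z = 0)"

definition paracontact_metric ::
  "('a, 'e::euclidean_space) atlas \<Rightarrow> nat \<Rightarrow> ('a vfield \<Rightarrow> 'a vfield) \<Rightarrow> 'a vfield \<Rightarrow>
    ('a vfield \<Rightarrow> 'a \<Rightarrow> real) \<Rightarrow> ('a vfield \<Rightarrow> 'a vfield \<Rightarrow> 'a \<Rightarrow> real) \<Rightarrow> bool" where
  "paracontact_metric A n \<phi> \<xi> \<eta> g \<longleftrightarrow>
    tensor_11 A \<phi> \<and> \<xi> \<in> vector_fields A \<and> one_form A \<eta> \<and> \<eta> \<xi> = 1 \<and>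
    (\<forall>X\<in>vector_fields A. \<phi> (\<phi> X) = X - \<eta> X \<odot> \<xi>) \<and>
    (\<forall>r\<in>{1, -1}. has_rank (eigendistribution A \<phi> r \<inter> contact_distribution A \<eta>) n) \<and>
    semi_riemannian_metric A g \<and>
    (\<forall>X\<in>vector_fields A. \<forall>Y\<in>vector_fields A.
      g (\<phi> X) (\<phi> Y) = - g X Y + \<eta> X * \<eta> Y \<and> ext_deriv \<eta> X Y = g X (\<phi> Y))"

definition contact_metric ::
  "('a, 'e::euclidean_space) atlas \<Rightarrow> ('a vfield \<Rightarrow> 'a vfield) \<Rightarrow> 'a vfield \<Rightarrow>
    ('a vfield \<Rightarrow> 'a \<Rightarrow> real) \<Rightarrow> ('a vfield \<Rightarrow> 'a vfield \<Rightarrow> 'a \<Rightarrow> real) \<Rightarrow> bool" where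
  "contact_metric A \<phi> \<xi> \<eta> g \<longleftrightarrow>
    tensor_11 A \<phi> \<and> \<xi> \<in> vector_fields A \<and> one_form A \<eta> \<and> \<eta> \<xi> = 1 \<and>
    (\<forall>X\<in>vector_fields A. \<phi> (\<phi> X) = - X + \<eta> X \<odot> \<xi>) \<and>
    riemannian_metric A g \<and>
    (\<forall>X\<in>vector_fields A. \<forall>Y\<in>vector_fields A.
      g (\<phi> X) (\<phi> Y) = g X Y - \<eta> X * \<eta> Y \<and> ext_deriv \<eta> X Y = g X (\<phi> Y))"

text \<open>The Levi-Civita connection exists and is unique (as a map on vector fields).\<close>

definition kappa_mu_condition ::
  "('a, 'e::euclidean_space) atlas \<Rightarrow> ('a vfield \<Rightarrow> 'a vfield) \<Rightarrow> 'a vfield \<Rightarrow>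
    ('a vfield \<Rightarrow> 'a \<Rightarrow> real) \<Rightarrow> ('a vfield \<Rightarrow> 'a vfield \<Rightarrow> 'a \<Rightarrow> real) \<Rightarrow> real \<Rightarrow> real \<Rightarrow> bool" where
  "kappa_mu_condition A \<phi> \<xi> \<eta> g \<kappa> \<mu> \<longleftrightarrow>
    (\<exists>D. levi_civita_connection A g D \<and>
      (\<forall>X\<in>vector_fields A. \<forall>Y\<in>vector_fields A.
        curvature D X Y \<xi> = \<kappa> \<cdot> (\<eta> Y \<odot> X - \<eta> X \<odot> Y)
          + \<mu> \<cdot> (\<eta> Y \<odot> half_lie \<xi> \<phi> X - \<eta> X \<odot> half_lie \<xi> \<phi> Y)))"

definition paracontact_metric_kappa_mu ::
  "('a, 'e::euclidean_space) atlas \<Rightarrow> nat \<Rightarrow> ('a vfield \<Rightarrow> 'a vfield) \<Rightarrow> 'a vfield \<Rightarrow>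
    ('a vfield \<Rightarrow> 'a \<Rightarrow> real) \<Rightarrow> ('a vfield \<Rightarrow> 'a vfield \<Rightarrow> 'a \<Rightarrow> real) \<Rightarrow> real \<Rightarrow> real \<Rightarrow> bool" where
  "paracontact_metric_kappa_mu A n \<phi> \<xi> \<eta> g \<kappa> \<mu> \<longleftrightarrow>
    paracontact_metric A n \<phi> \<xi> \<eta> g \<and> kappa_mu_condition A \<phi> \<xi> \<eta> g \<kappa> \<mu>"

definition contact_metric_kappa_mu ::
  "('a, 'e::euclidean_space) atlas \<Rightarrow> ('a vfield \<Rightarrow> 'a vfield) \<Rightarrow> 'a vfield \<Rightarrow>
    ('a vfield \<Rightarrow> 'a \<Rightarrow> real) \<Rightarrow> ('a vfield \<Rightarrow> 'a vfield \<Rightarrow> 'a \<Rightarrow> real) \<Rightarrow> real \<Rightarrow> real \<Rightarrow> bool" where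
  "contact_metric_kappa_mu A \<phi> \<xi> \<eta> g \<kappa> \<mu> \<longleftrightarrow>
    contact_metric A \<phi> \<xi> \<eta> g \<and> kappa_mu_condition A \<phi> \<xi> \<eta> g \<kappa> \<mu>"

definition standard_almost_bi_paracontact ::
  "('a, 'e::euclidean_space) atlas \<Rightarrow> ('a vfield \<Rightarrow> 'a vfield) \<Rightarrow> 'a vfield \<Rightarrow>
    ('a vfield \<Rightarrow> 'a \<Rightarrow> real) \<Rightarrow> ('a vfield \<Rightarrow> 'a vfield \<Rightarrow> 'a \<Rightarrow> real) \<Rightarrow> real \<Rightarrow> real \<Rightarrow>
    ('a vfield \<Rightarrow> 'a vfield) \<Rightarrow> ('a vfield \<Rightarrow> 'a vfield) \<Rightarrow> ('a vfield \<Rightarrow> 'a vfield) \<Rightarrow> bool" where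
  "standard_almost_bi_paracontact A \<phi> \<xi> \<eta> g \<kappa> \<mu> \<phi>\<^sub>1 \<phi>\<^sub>2 \<phi>\<^sub>3 \<longleftrightarrow>
    contact_metric_kappa_mu A \<phi> \<xi> \<eta> g \<kappa> \<mu> \<and> \<kappa> < 1 \<and>
    (\<forall>X\<in>vector_fields A.
      \<phi>\<^sub>1 X = (1 / sqrt (1 - \<kappa>)) \<cdot> \<phi> (half_lie \<xi> \<phi> X) \<and>
      \<phi>\<^sub>2 X = (1 / sqrt (1 - \<kappa>)) \<cdot> half_lie \<xi> \<phi> X \<and>
      \<phi>\<^sub>3 X = \<phi> X)"

end

theory Submission
  imports Defs
begin

text \<open>The theorem is true because the Levi-Civita connections of the three metrics can be written
  down in terms of the canonical connection \<open>\<nabla>\<^sup>c\<close>. What remains is linear algebra in the module of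
  vector fields over the ring of smooth functions.

  Comparison of the given \<open>\<nabla>\<^sup>c \<phi>\<^sub>\<alpha>\<close> with \<open>(2/3) \<eta> \<otimes> h\<^sub>\<alpha>\<close> gives \<open>h\<^sub>1 = - (3/2) a \<phi>\<^sub>2\<close>,
  \<open>h\<^sub>2 = (3/2) (a \<phi>\<^sub>1 + b \<phi>\<^sub>3)\<close> and \<open>h\<^sub>3 = (3/2) b \<phi>\<^sub>2\<close> (\<open>half_lie_\<phi>\<close>), which is already the shape of a
  standard structure. Integrability makes every \<open>\<phi>\<^sub>\<alpha>\<close> skew with respect to \<open>d\<eta>\<close> (\<open>d\<eta>_\<phi>\<close>), so the
  \<open>g\<^sub>\<alpha>\<close> are symmetric, and it reduces the torsion of \<open>\<nabla>\<^sup>c\<close> to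
  \<open>T(X,Y) = 2 d\<eta>(X,Y) \<xi> - \<eta>(X) P Y + \<eta>(Y) P X\<close> with \<open>P = a \<phi>\<^sub>3 + b \<phi>\<^sub>1\<close> (\<open>torsion_Dc\<close>).

  For such a torsion, the connection
  \<open>\<nabla>\<^sub>X Y = \<nabla>\<^sup>c\<^sub>X Y - g(V X, Y) \<xi> + \<eta>(X) (V + P) Y + \<eta>(Y) V X\<close> is torsion-free as soon as \<open>d\<eta>\<close>
  is the skew part of \<open>g(V \<sqdot>, \<sqdot>)\<close>, and metric as soon as \<open>\<nabla>\<^sup>c g\<close> is \<open>\<eta>\<close> times twice the symmetric part
  of \<open>g((V + P) \<sqdot>, \<sqdot>)\<close> (\<open>levi_civita_nabla\<close>). Together these conditions determine \<open>V\<close>; for \<open>g\<^sub>\<alpha>\<close> it is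
  \<open>- \<phi>\<^sub>\<alpha> + \<epsilon>\<^sub>\<alpha> \<phi>\<^sub>\<alpha> h\<^sub>\<alpha>\<close> with \<open>\<epsilon>\<^sub>1 = \<epsilon>\<^sub>2 = 1\<close> and \<open>\<epsilon>\<^sub>3 = -1\<close>. Moreover \<open>\<nabla>\<xi> = V\<close>, so that
  \<open>R(X,Y) \<xi> = \<eta>(X) W Y - \<eta>(Y) W X\<close> with \<open>W = V' + V\<^sup>2 + P V - V P\<close> and \<open>\<nabla>\<^sup>c V = \<eta> \<otimes> V'\<close>
  (\<open>curvature_nabla_\<xi>\<close>). All operators in \<open>W\<close> are combinations of \<open>\<phi>\<^sub>1\<close>, \<open>\<phi>\<^sub>2\<close>, \<open>\<phi>\<^sub>3\<close>, and the
  multiplication table of these gives \<open>W = - \<kappa>\<^sub>\<alpha> (I - \<eta> \<otimes> \<xi>) - \<mu>\<^sub>\<alpha> h\<^sub>\<alpha>\<close>.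

  Finally \<open>\<pi>\<^sub>1 = (3/2) a g\<^sub>3\<close> on \<open>\<D>\<close>, which makes \<open>g\<^sub>3\<close> positive definite there. Nondegeneracy of
  \<open>g\<^sub>1\<close> and \<open>g\<^sub>2\<close> follows because \<open>g\<^sub>1(X, \<phi>\<^sub>2 X)\<close> and \<open>g\<^sub>2(X, \<phi>\<^sub>1 X)\<close> are \<open>\<mp> g\<^sub>3(X, X)\<close> on \<open>\<D>\<close>.\<close>

section \<open>The algebra of smooth functions\<close>

lemma Ck_on_cong:
  assumes "open S" "\<And>x. x \<in> S \<Longrightarrow> f x = g x"
  shows "Ck_on k S f \<longleftrightarrow> Ck_on k S g"
  using assms(2)
proof (induction k arbitrary: f g)
  case 0
  then show ?case
    by (auto cong: continuous_on_cong)
next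
  case (Suc k)
  have transfer: "v differentiable (at x) \<and> frechet_derivative v (at x) = frechet_derivative u (at x)"
    if "x \<in> S" "u differentiable (at x)" "\<And>x. x \<in> S \<Longrightarrow> u x = v x" for u v :: "'a \<Rightarrow> 'b" and x
    using has_derivative_transform_within_open[where f=u and g=v and t=UNIV, OF _ \<open>open S\<close> that(1,3)]
      frechet_derivative_transform_within_open[OF that(2) \<open>open S\<close> that(1,3)] that(2)
    unfolding differentiable_def by (metis (full_types))
  show ?case
  proof (cases "\<forall>x\<in>S. f differentiable (at x)")
    case True
    then have "Ck_on k S (\<lambda>x. frechet_derivative f (at x) v)
        = Ck_on k S (\<lambda>x. frechet_derivative g (at x) v)" for v
      using transfer[of _ f g] Suc.prems by (intro Suc.IH) auto
    with True show ?thesis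
      using transfer[of _ f g] Suc.prems by auto
  next
    case False
    then show ?thesis
      using transfer[of _ g f] Suc.prems by auto
  qed
qed

lemma Ck_on_SucD: "Ck_on (Suc k) S f \<Longrightarrow> Ck_on k S f"
proof (induction k arbitrary: f)
  case 0
  then show ?case
    by (auto intro!: continuous_at_imp_continuous_on differentiable_imp_continuous_within)
next
  case (Suc k)
  then show ?case
    by (metis Ck_on.simps(2))
qed

lemma Ck_on_const: "Ck_on k S (\<lambda>_. c)"
  by (induction k arbitrary: c) auto

lemma Ck_on_add:
  assumes "open S" "Ck_on k S f" "Ck_on k S g"
  shows "Ck_on k S (\<lambda>x. f x + g x)"
  using assms(2,3)
proof (induction k arbitrary: f g)
  case 0
  then show ?case by (auto intro: continuous_on_add)
next
  case (Suc k)
  have "frechet_derivative (\<lambda>x. f x + g x) (at x)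
      = (\<lambda>v. frechet_derivative f (at x) v + frechet_derivative g (at x) v)" if "x \<in> S" for x
    using Suc.prems that
    by (intro frechet_derivative_at[symmetric] has_derivative_add)
       (auto simp: frechet_derivative_works[symmetric])
  then have "Ck_on k S (\<lambda>x. frechet_derivative (\<lambda>x. f x + g x) (at x) v)" for v
    using Suc.IH[of "\<lambda>x. frechet_derivative f (at x) v" "\<lambda>x. frechet_derivative g (at x) v"] Suc.prems
    by (subst Ck_on_cong[OF \<open>open S\<close>]) auto
  with Suc.prems show ?case by auto
qed

lemma Ck_on_mult:
  fixes f g :: "'e::euclidean_space \<Rightarrow> real"
  assumes "open S" "Ck_on k S f" "Ck_on k S g"
  shows "Ck_on k S (\<lambda>x. f x * g x)"
  using assms(2,3)
proof (induction k arbitrary: f g)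
  case 0
  then show ?case by (auto intro: continuous_on_mult)
next
  case (Suc k)
  have der: "frechet_derivative (\<lambda>x. f x * g x) (at x)
      = (\<lambda>v. f x * frechet_derivative g (at x) v + frechet_derivative f (at x) v * g x)" if "x \<in> S" for x
    using Suc.prems that
    by (intro frechet_derivative_at[symmetric] has_derivative_mult)
       (auto simp: frechet_derivative_works[symmetric])
  have "Ck_on k S (\<lambda>x. f x * frechet_derivative g (at x) v + frechet_derivative f (at x) v * g x)" for v
    using Suc.prems Ck_on_SucD[OF Suc.prems(1)] Ck_on_SucD[OF Suc.prems(2)]
    by (intro Ck_on_add[OF \<open>open S\<close>] Suc.IH) auto
  then have "Ck_on k S (\<lambda>x. frechet_derivative (\<lambda>x. f x * g x) (at x) v)" for v
    using der by (subst Ck_on_cong[OF \<open>open S\<close>]) auto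
  with Suc.prems show ?case
    by auto
qed

text \<open>Sums and products of functions have to keep their form: inside the argument of a vector field
  they are subject to linearity and to the Leibniz rule.\<close>

declare plus_fun_apply [simp del] times_fun_apply [simp del] zero_fun_apply [simp del]
  one_fun_apply [simp del] minus_apply [simp del] uminus_apply [simp del]

lemma fscale_apply: "(u \<odot> X) f p = u p * X f p"
  by (simp add: fscale_def times_fun_apply)

lemma cscale_apply: "(r \<cdot> X) f p = r * X f p"
  by (simp add: cscale_def fscale_apply)

text \<open>Once all operators have been pushed down to generators, an identity between vector fields is
  an identity between real numbers, obtained by evaluation at a function and a point.\<close>

lemmas pointwise = fun_eq_iff plus_fun_apply times_fun_apply zero_fun_apply one_fun_apply
  minus_apply uminus_apply numeral_fun_apply fscale_apply cscale_apply

lemma fscale_0 [simp]: "0 \<odot> X = 0" "u \<odot> 0 = 0" and fscale_1 [simp]: "1 \<odot> X = X"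
  and cscale_0 [simp]: "0 \<cdot> X = 0" "r \<cdot> 0 = 0"
  by (simp_all add: pointwise)

text \<open>Evaluation at a function only: the values are smooth functions, to which another vector field
  can still be applied.\<close>

lemmas at_function = plus_fun_apply[where 'b = "'b \<Rightarrow> real"] minus_apply[where 'b = "'b \<Rightarrow> real"]
  uminus_apply[where 'b = "'b \<Rightarrow> real"] zero_fun_apply[where 'b = "'b \<Rightarrow> real"]

lemma uminus_as_fscale: "- X = (\<lambda>_. - 1) \<odot> X"
  by (simp add: pointwise)

locale smooth_manifold =
  fixes A :: "('a::{t2_space,second_countable_topology}, 'e::euclidean_space) atlas"
  assumes atlas: "smooth_atlas A"
begin

abbreviation SF where "SF \<equiv> smooth_functions A"
abbreviation VF where "VF \<equiv> vector_fields A"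

lemma open_chart_image: "(U, c) \<in> A \<Longrightarrow> open (c ` U)"
  using atlas by (auto simp: smooth_atlas_def)

lemma SF_const [simp]: "(\<lambda>_. r) \<in> SF"
  by (auto simp: smooth_functions_def smooth_on_def o_def Ck_on_const)

lemma SF_add [simp]: "f \<in> SF \<Longrightarrow> g \<in> SF \<Longrightarrow> f + g \<in> SF"
  using Ck_on_add[OF open_chart_image]
  by (auto simp: smooth_functions_def smooth_on_def o_def plus_fun_apply times_fun_apply) blast

lemma SF_mult [simp]: "f \<in> SF \<Longrightarrow> g \<in> SF \<Longrightarrow> f * g \<in> SF"
  using Ck_on_mult[OF open_chart_image]
  by (auto simp: smooth_functions_def smooth_on_def o_def plus_fun_apply times_fun_apply) blast

lemma SF_0 [simp]: "0 \<in> SF" and SF_1 [simp]: "1 \<in> SF"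
  using SF_const by (auto simp: zero_fun_def one_fun_def)

lemma SF_uminus [simp]: "f \<in> SF \<Longrightarrow> - f \<in> SF"
  using SF_mult[OF SF_const[of "-1"], of f] by (simp add: fun_Compl_def times_fun_def)

lemma SF_diff [simp]: "f \<in> SF \<Longrightarrow> g \<in> SF \<Longrightarrow> f - g \<in> SF"
  using SF_add[OF _ SF_uminus, of f g] by simp

section \<open>The Lie algebra of vector fields\<close>

context
  fixes X assumes X: "X \<in> VF"
begin

lemma VF_SF [simp]: "f \<in> SF \<Longrightarrow> X f \<in> SF"
  and VF_apply_add [simp]: "f \<in> SF \<Longrightarrow> g \<in> SF \<Longrightarrow> X (f + g) = X f + X g"
  and VF_apply_cmult: "f \<in> SF \<Longrightarrow> X ((\<lambda>_. r) * f) = (\<lambda>_. r) * X f"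
  and VF_apply_mult [simp]: "f \<in> SF \<Longrightarrow> g \<in> SF \<Longrightarrow> X (f * g) = X f * g + f * X g"
  and VF_nonsmooth [simp]: "f \<notin> SF \<Longrightarrow> X f = 0"
  using X by (auto simp: vector_fields_def)

lemma VF_apply_const [simp]: "X (\<lambda>_. r) = 0"
proof -
  \<comment> \<open>Leibniz rule for \<open>1 = 1 * 1\<close>\<close>
  have "X 1 = X 1 + X 1"
    using VF_apply_mult[of 1 1] by simp
  then have "X 1 = 0" by simp
  with VF_apply_cmult[of 1 r] show ?thesis
    by simp
qed

lemma VF_apply_0 [simp]: "X 0 = 0" and VF_apply_1 [simp]: "X 1 = 0"
  using VF_apply_const by (auto simp: zero_fun_def one_fun_def)

lemma VF_apply_uminus [simp]: "f \<in> SF \<Longrightarrow> X (- f) = - X f"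
  using VF_apply_add[of f "- f"] by (simp add: eq_neg_iff_add_eq_0 add.commute)

lemma VF_apply_diff [simp]: "f \<in> SF \<Longrightarrow> g \<in> SF \<Longrightarrow> X (f - g) = X f - X g"
  using VF_apply_add[of f "- g"] by simp

end

lemma VF_I:
  assumes "\<And>f. f \<in> SF \<Longrightarrow> X f \<in> SF"
    and "\<And>f g. f \<in> SF \<Longrightarrow> g \<in> SF \<Longrightarrow> X (f + g) = X f + X g"
    and "\<And>f r. f \<in> SF \<Longrightarrow> X ((\<lambda>_. r) * f) = (\<lambda>_. r) * X f"
    and "\<And>f g. f \<in> SF \<Longrightarrow> g \<in> SF \<Longrightarrow> X (f * g) = X f * g + f * X g"
    and "\<And>f. f \<notin> SF \<Longrightarrow> X f = 0"
  shows "X \<in> VF"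
  unfolding vector_fields_def mem_Collect_eq by (intro conjI ballI allI impI assms)

lemma VF_add [simp]: "X \<in> VF \<Longrightarrow> Y \<in> VF \<Longrightarrow> X + Y \<in> VF"
  by (rule VF_I) (simp_all add: VF_apply_cmult plus_fun_apply[where f=X] algebra_simps)

lemma VF_fscale [simp]: "u \<in> SF \<Longrightarrow> X \<in> VF \<Longrightarrow> u \<odot> X \<in> VF"
  by (rule VF_I) (simp_all add: fscale_def VF_apply_cmult pointwise algebra_simps)

lemma VF_cscale [simp]: "X \<in> VF \<Longrightarrow> r \<cdot> X \<in> VF"
  by (simp add: cscale_def)

lemma VF_0 [simp]: "0 \<in> VF"
  by (rule VF_I) (auto simp: zero_fun_apply[where 'a="'a \<Rightarrow> real"])

lemma VF_uminus [simp]: "X \<in> VF \<Longrightarrow> - X \<in> VF"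
  by (simp add: uminus_as_fscale)

lemma VF_diff [simp]: "X \<in> VF \<Longrightarrow> Y \<in> VF \<Longrightarrow> X - Y \<in> VF"
  using VF_add[OF _ VF_uminus, of X Y] by simp

lemma VF_lie_bracket [simp]:
  assumes X: "X \<in> VF" and Y: "Y \<in> VF"
  shows "lie_bracket X Y \<in> VF"
  using assms
  by (intro VF_I; simp add: lie_bracket_def VF_apply_cmult; simp add: algebra_simps)

lemma lie_bracket_skew: "lie_bracket Y X = - lie_bracket X Y"
  by (rule ext) (simp add: lie_bracket_def at_function)

lemma lie_bracket_self [simp]: "lie_bracket X X = 0"
  by (rule ext) (simp add: lie_bracket_def at_function)

lemma lie_bracket_add:
  assumes "X \<in> VF" "Y \<in> VF" "Z \<in> VF"
  shows "lie_bracket (X + Y) Z = lie_bracket X Z + lie_bracket Y Z"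
    and "lie_bracket Z (X + Y) = lie_bracket Z X + lie_bracket Z Y"
proof -
  have "lie_bracket (X + Y) Z f = (lie_bracket X Z + lie_bracket Y Z) f
      \<and> lie_bracket Z (X + Y) f = (lie_bracket Z X + lie_bracket Z Y) f" for f
    using assms by (cases "f \<in> SF") (simp_all add: lie_bracket_def at_function)
  then show "lie_bracket (X + Y) Z = lie_bracket X Z + lie_bracket Y Z"
    "lie_bracket Z (X + Y) = lie_bracket Z X + lie_bracket Z Y" by blast+
qed

lemma lie_bracket_fscale:
  assumes "X \<in> VF" "Y \<in> VF" "u \<in> SF"
  shows "lie_bracket (u \<odot> X) Y = u \<odot> lie_bracket X Y - Y u \<odot> X"
    and "lie_bracket X (u \<odot> Y) = u \<odot> lie_bracket X Y + X u \<odot> Y"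
proof -
  have "lie_bracket (u \<odot> X) Y f = (u \<odot> lie_bracket X Y - Y u \<odot> X) f
      \<and> lie_bracket X (u \<odot> Y) f = (u \<odot> lie_bracket X Y + X u \<odot> Y) f" for f
    using assms
    by (cases "f \<in> SF"; simp add: lie_bracket_def fscale_def at_function;
        simp add: pointwise algebra_simps)
  then show "lie_bracket (u \<odot> X) Y = u \<odot> lie_bracket X Y - Y u \<odot> X"
    "lie_bracket X (u \<odot> Y) = u \<odot> lie_bracket X Y + X u \<odot> Y" by blast+
qed

lemma lie_bracket_uminus:
  assumes "X \<in> VF" "Y \<in> VF"
  shows "lie_bracket (- X) Y = - lie_bracket X Y" and "lie_bracket X (- Y) = - lie_bracket X Y"
  using lie_bracket_fscale[OF assms SF_const[of "- 1"]] assms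
  by (simp_all add: uminus_as_fscale)

lemma lie_bracket_0: "X \<in> VF \<Longrightarrow> lie_bracket 0 X = 0" "X \<in> VF \<Longrightarrow> lie_bracket X 0 = 0"
  by (simp_all add: lie_bracket_def fun_eq_iff at_function)

lemma lie_bracket_diff:
  assumes "X \<in> VF" "Y \<in> VF" "Z \<in> VF"
  shows "lie_bracket (X - Y) Z = lie_bracket X Z - lie_bracket Y Z"
    and "lie_bracket Z (X - Y) = lie_bracket Z X - lie_bracket Z Y"
  using lie_bracket_add[of X "- Y" Z] assms by (simp_all add: lie_bracket_uminus)

section \<open>Tensor fields\<close>

lemma
  assumes "one_form A \<omega>" "X \<in> VF"
  shows one_form_SF: "\<omega> X \<in> SF"
    and one_form_add: "Y \<in> VF \<Longrightarrow> \<omega> (X + Y) = \<omega> X + \<omega> Y"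
    and one_form_fscale: "u \<in> SF \<Longrightarrow> \<omega> (u \<odot> X) = u * \<omega> X"
  using assms by (auto simp: one_form_def)

lemma
  assumes "one_form A \<omega>" "X \<in> VF"
  shows one_form_cscale: "\<omega> (r \<cdot> X) = (\<lambda>_. r) * \<omega> X"
    and one_form_uminus: "\<omega> (- X) = - \<omega> X"
    and one_form_diff: "Y \<in> VF \<Longrightarrow> \<omega> (X - Y) = \<omega> X - \<omega> Y"
    and one_form_0: "\<omega> 0 = 0"
proof -
  show "\<omega> (r \<cdot> X) = (\<lambda>_. r) * \<omega> X" for r
    using assms by (simp add: cscale_def one_form_fscale)
  have neg: "\<omega> (- X) = - \<omega> X" if "X \<in> VF" for X
    using assms that by (simp add: uminus_as_fscale[of X] one_form_fscale) (simp add: pointwise)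
  then show "\<omega> (- X) = - \<omega> X"
    using assms by blast
  show "\<omega> (X - Y) = \<omega> X - \<omega> Y" if "Y \<in> VF"
    using one_form_add[OF assms, of "- Y"] neg that by simp
  show "\<omega> 0 = 0"
    using one_form_add[OF assms(1), of 0 0] by simp
qed

lemmas one_form_simps =
  one_form_SF one_form_add one_form_fscale one_form_cscale one_form_uminus one_form_diff

lemma
  assumes "tensor_11 A \<phi>" "X \<in> VF"
  shows tensor_11_VF: "\<phi> X \<in> VF"
    and tensor_11_add: "Y \<in> VF \<Longrightarrow> \<phi> (X + Y) = \<phi> X + \<phi> Y"
    and tensor_11_fscale: "u \<in> SF \<Longrightarrow> \<phi> (u \<odot> X) = u \<odot> \<phi> X"
  using assms by (auto simp: tensor_11_def)

lemma
  assumes "tensor_11 A \<phi>" "X \<in> VF"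
  shows tensor_11_cscale: "\<phi> (r \<cdot> X) = r \<cdot> \<phi> X"
    and tensor_11_uminus: "\<phi> (- X) = - \<phi> X"
    and tensor_11_diff: "Y \<in> VF \<Longrightarrow> \<phi> (X - Y) = \<phi> X - \<phi> Y"
    and tensor_11_0: "\<phi> 0 = 0"
proof -
  show "\<phi> (r \<cdot> X) = r \<cdot> \<phi> X" for r
    using assms by (simp add: cscale_def tensor_11_fscale)
  have neg: "\<phi> (- X) = - \<phi> X" if "X \<in> VF" for X
    using assms that by (simp add: uminus_as_fscale tensor_11_fscale)
  then show "\<phi> (- X) = - \<phi> X"
    using assms by blast
  show "\<phi> (X - Y) = \<phi> X - \<phi> Y" if "Y \<in> VF"
    using tensor_11_add[OF assms, of "- Y"] neg that by simp
  show "\<phi> 0 = 0"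
    using tensor_11_add[OF assms(1), of 0 0] by simp
qed

lemmas tensor_11_simps =
  tensor_11_VF tensor_11_add tensor_11_fscale tensor_11_cscale tensor_11_uminus tensor_11_diff

lemma
  assumes "tensor_02 A g" "X \<in> VF" "Y \<in> VF"
  shows tensor_02_SF: "g X Y \<in> SF"
    and tensor_02_add_left: "Z \<in> VF \<Longrightarrow> g (X + Z) Y = g X Y + g Z Y"
    and tensor_02_add_right: "Z \<in> VF \<Longrightarrow> g X (Y + Z) = g X Y + g X Z"
    and tensor_02_diff_left: "Z \<in> VF \<Longrightarrow> g (X - Z) Y = g X Y - g Z Y"
    and tensor_02_diff_right: "Z \<in> VF \<Longrightarrow> g X (Y - Z) = g X Y - g X Z"
    and tensor_02_uminus_left: "g (- X) Y = - g X Y"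
    and tensor_02_uminus_right: "g X (- Y) = - g X Y"
    and tensor_02_fscale_left: "u \<in> SF \<Longrightarrow> g (u \<odot> X) Y = u * g X Y"
    and tensor_02_fscale_right: "u \<in> SF \<Longrightarrow> g X (u \<odot> Y) = u * g X Y"
    and tensor_02_cscale_left: "g (r \<cdot> X) Y = (\<lambda>_. r) * g X Y"
    and tensor_02_cscale_right: "g X (r \<cdot> Y) = (\<lambda>_. r) * g X Y"
proof -
  have "one_form A (g X)" "one_form A (\<lambda>X. g X Y)"
    using assms by (auto simp: tensor_02_def)
  note r = one_form_simps[OF this(1) \<open>Y \<in> VF\<close>] one_form_simps[OF this(2) \<open>X \<in> VF\<close>]
  show "g X Y \<in> SF" "g (- X) Y = - g X Y" "g X (- Y) = - g X Y"
    "g (r \<cdot> X) Y = (\<lambda>_. r) * g X Y" "g X (r \<cdot> Y) = (\<lambda>_. r) * g X Y"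
    by (rule r)+
  show "g (X + Z) Y = g X Y + g Z Y" "g X (Y + Z) = g X Y + g X Z"
    "g (X - Z) Y = g X Y - g Z Y" "g X (Y - Z) = g X Y - g X Z" if "Z \<in> VF"
    using that by (rule r)+
  show "g (u \<odot> X) Y = u * g X Y" "g X (u \<odot> Y) = u * g X Y" if "u \<in> SF"
    using that by (rule r)+
qed

lemmas tensor_02_simps =
  tensor_02_SF tensor_02_add_left tensor_02_add_right tensor_02_diff_left tensor_02_diff_right
  tensor_02_uminus_left tensor_02_uminus_right tensor_02_fscale_left tensor_02_fscale_right
  tensor_02_cscale_left tensor_02_cscale_right

text \<open>When an argument is scaled by \<open>u\<close>, the derivative of \<open>u\<close> from \<open>X (\<eta> Y) - Y (\<eta> X)\<close> cancels the
  one from \<open>\<eta> [X, Y]\<close>.\<close>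

lemma tensor_02_ext_deriv:
  assumes \<eta>: "one_form A \<eta>"
  shows "tensor_02 A (ext_deriv \<eta>)"
proof -
  have ext: "ext_deriv \<eta> X Y = (\<lambda>_. 1/2) * (X (\<eta> Y) - Y (\<eta> X) - \<eta> (lie_bracket X Y))" for X Y
    by (simp add: ext_deriv_def pointwise)
  show ?thesis
    unfolding tensor_02_def one_form_def
    by (intro conjI ballI; simp add: ext one_form_simps[OF \<eta>] lie_bracket_add lie_bracket_fscale;
        simp add: pointwise algebra_simps)
qed

end

section \<open>Connections on a contact manifold\<close>

lemma (in smooth_manifold)
  assumes "linear_connection A D" "X \<in> VF" "Y \<in> VF"
  shows linear_connection_VF: "D X Y \<in> VF"
    and linear_connection_add_left: "Z \<in> VF \<Longrightarrow> D (X + Z) Y = D X Y + D Z Y"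
    and linear_connection_add_right: "Z \<in> VF \<Longrightarrow> D X (Y + Z) = D X Y + D X Z"
    and linear_connection_fscale_left: "u \<in> SF \<Longrightarrow> D (u \<odot> X) Y = u \<odot> D X Y"
    and linear_connection_fscale_right: "u \<in> SF \<Longrightarrow> D X (u \<odot> Y) = X u \<odot> Y + u \<odot> D X Y"
  using assms by (auto simp: linear_connection_def)

lemma (in smooth_manifold)
  assumes "linear_connection A D" "X \<in> VF" "Y \<in> VF"
  shows linear_connection_cscale_right: "D X (r \<cdot> Y) = r \<cdot> D X Y"
    and linear_connection_uminus_right: "D X (- Y) = - D X Y"
    and linear_connection_diff_right: "Z \<in> VF \<Longrightarrow> D X (Y - Z) = D X Y - D X Z"
    and linear_connection_diff_left: "Z \<in> VF \<Longrightarrow> D (X - Z) Y = D X Y - D Z Y"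
proof -
  show "D X (r \<cdot> Y) = r \<cdot> D X Y" for r
    using assms by (simp add: cscale_def linear_connection_fscale_right)
  have neg: "D X (- Y) = - D X Y" if "Y \<in> VF" for Y
    using assms that by (simp add: uminus_as_fscale linear_connection_fscale_right)
  then show "D X (- Y) = - D X Y"
    using assms by blast
  show "D X (Y - Z) = D X Y - D X Z" if "Z \<in> VF"
    using linear_connection_add_right[OF assms, of "- Z"] neg that by simp
  show "D (X - Z) Y = D X Y - D Z Y" if "Z \<in> VF"
    using linear_connection_add_left[OF assms(1), of "X - Z" Y Z] assms that
    by (simp add: algebra_simps)
qed

lemmas (in smooth_manifold) linear_connection_simps =
  linear_connection_cscale_right linear_connection_uminus_right linear_connection_diff_right linear_connection_diff_left
  linear_connection_VF linear_connection_add_left linear_connection_add_right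
  linear_connection_fscale_left linear_connection_fscale_right

locale contact_form = smooth_manifold A
  for A :: "('a::{t2_space,second_countable_topology}, 'e::euclidean_space) atlas" +
  fixes \<eta> :: "'a vfield \<Rightarrow> 'a \<Rightarrow> real" and \<xi> :: "'a vfield"
  assumes one_form_\<eta>: "one_form A \<eta>" and reeb: "reeb_field A \<eta> \<xi>"
begin

abbreviation d\<eta> where "d\<eta> \<equiv> ext_deriv \<eta>"

lemmas tensor_d\<eta> = tensor_02_ext_deriv[OF one_form_\<eta>]

lemmas \<eta>_simps [simp] = one_form_simps[OF one_form_\<eta>]
lemmas d\<eta>_simps [simp] = tensor_02_simps[OF tensor_d\<eta>]

lemma \<xi>_VF [simp]: "\<xi> \<in> VF" and \<eta>_\<xi> [simp]: "\<eta> \<xi> = 1"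
  and d\<eta>_\<xi>_left [simp]: "X \<in> VF \<Longrightarrow> d\<eta> \<xi> X = 0"
  using reeb by (auto simp: reeb_field_def)

lemma \<eta>_0 [simp]: "\<eta> 0 = 0"
  by (rule one_form_0[OF one_form_\<eta> \<xi>_VF])

lemma d\<eta>_skew: "X \<in> VF \<Longrightarrow> Y \<in> VF \<Longrightarrow> d\<eta> Y X = - d\<eta> X Y"
  by (simp add: ext_deriv_def lie_bracket_skew[of X Y]) (simp add: pointwise field_simps)

lemma d\<eta>_\<xi>_right [simp]: "X \<in> VF \<Longrightarrow> d\<eta> X \<xi> = 0"
  using d\<eta>_skew[of \<xi> X] by simp

lemma d\<eta>_0 [simp]: "X \<in> VF \<Longrightarrow> d\<eta> 0 X = 0" "X \<in> VF \<Longrightarrow> d\<eta> X 0 = 0"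
  using d\<eta>_simps(4)[of X X X] d\<eta>_simps(5)[of X X X] by simp_all

lemma d\<eta>_contact_distribution:
  assumes "X \<in> VF" "Y \<in> VF" "\<eta> X = 0" "\<eta> Y = 0"
  shows "\<eta> (lie_bracket X Y) = (\<lambda>_. - 2) * d\<eta> X Y"
  using assms by (simp add: ext_deriv_def) (simp add: pointwise)

end

text \<open>The torsion of \<open>D\<close> has the form that the canonical connection will turn out to have, with
  \<open>P = a \<phi>\<^sub>3 + b \<phi>\<^sub>1\<close>. It is simple enough for the Levi-Civita connections of suitable metrics to be
  given by a formula, without the Koszul identity and the duality between forms and fields.\<close>

locale contact_connection = contact_form A \<eta> \<xi>
  for A :: "('a::{t2_space,second_countable_topology}, 'e::euclidean_space) atlas"
    and \<eta> :: "'a vfield \<Rightarrow> 'a \<Rightarrow> real" and \<xi> :: "'a vfield" +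
  fixes D :: "'a vfield \<Rightarrow> 'a vfield \<Rightarrow> 'a vfield" and P :: "'a vfield \<Rightarrow> 'a vfield"
  assumes connection: "linear_connection A D"
    and D_\<xi>: "X \<in> VF \<Longrightarrow> D X \<xi> = 0"
    and D_\<eta>: "X \<in> VF \<Longrightarrow> Y \<in> VF \<Longrightarrow> \<eta> (D X Y) = X (\<eta> Y)"
    and tensor_P: "tensor_11 A P"
    and torsion_D: "X \<in> VF \<Longrightarrow> Y \<in> VF \<Longrightarrow>
      torsion D X Y = 2 \<cdot> d\<eta> X Y \<odot> \<xi> - \<eta> X \<odot> P Y + \<eta> Y \<odot> P X"
begin

lemmas D_simps = linear_connection_simps[OF connection]

lemma lie_bracket_torsion:
  assumes "X \<in> VF" "Y \<in> VF"
  shows "lie_bracket X Y = D X Y - D Y X - 2 \<cdot> d\<eta> X Y \<odot> \<xi> + \<eta> X \<odot> P Y - \<eta> Y \<odot> P X"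
  using torsion_D[OF assms] by (simp add: torsion_def pointwise algebra_simps)

text \<open>The endomorphism \<open>V\<close> is the covariant derivative of \<open>\<xi>\<close> for the Levi-Civita connection of \<open>g\<close>,
  and \<open>V'\<close> is the derivative of \<open>V\<close> along \<open>\<xi>\<close> for \<open>D\<close>.\<close>

context
  fixes g V V'
  assumes sym_g: "symmetric_tensor A g"
    and g_\<xi>: "X \<in> VF \<Longrightarrow> g \<xi> X = \<eta> X"
    and tensor_V: "tensor_11 A V"
    and V_\<xi>: "V \<xi> = 0"
    and \<eta>_V: "X \<in> VF \<Longrightarrow> \<eta> (V X) = 0"
    and P_\<xi>: "P \<xi> = 0"
    and skew_V: "X \<in> VF \<Longrightarrow> Y \<in> VF \<Longrightarrow> g (V X) Y - g (V Y) X = (\<lambda>_. 2) * d\<eta> X Y"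
    and D_g: "X \<in> VF \<Longrightarrow> Y \<in> VF \<Longrightarrow> Z \<in> VF \<Longrightarrow>
      cov_deriv_02 D g Z X Y = \<eta> Z * (g (V X + P X) Y + g X (V Y + P Y))"
    and D_V: "X \<in> VF \<Longrightarrow> Y \<in> VF \<Longrightarrow> D X (V Y) = V (D X Y) + \<eta> X \<odot> V' Y"
begin

definition nabla where
  "nabla X Y = D X Y - g (V X) Y \<odot> \<xi> + \<eta> X \<odot> (V Y + P Y) + \<eta> Y \<odot> V X"

lemma g_commute: "X \<in> VF \<Longrightarrow> Y \<in> VF \<Longrightarrow> g X Y = g Y X"
  and tensor_g: "tensor_02 A g"
  using sym_g by (auto simp: symmetric_tensor_def)

text \<open>Antisymmetrization of \<open>nabla - D\<close> gives \<open>- T\<close>, by the hypothesis on \<open>g(V X, Y) - g(V Y, X)\<close>. In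
  the derivative of \<open>g\<close> the contribution of \<open>g (V X) Y \<odot> \<xi>\<close> cancels that of \<open>\<eta> Y \<odot> V X\<close>, and what
  remains is the hypothesis on \<open>D g\<close>.\<close>

lemma levi_civita_nabla: "levi_civita_connection A g nabla"
  unfolding levi_civita_connection_def
proof (intro conjI ballI)
  note [simp] = tensor_11_simps[OF tensor_V] tensor_11_simps[OF tensor_P]
    tensor_02_simps[OF tensor_g] D_simps
  show "linear_connection A nabla"
    unfolding linear_connection_def nabla_def
    by (intro conjI ballI; simp; simp add: pointwise algebra_simps)
  show "torsion nabla X Y = 0" if "X \<in> VF" "Y \<in> VF" for X Y
    using that skew_V[OF that]
    by (simp add: torsion_def nabla_def lie_bracket_torsion) (simp add: pointwise algebra_simps)
  show "cov_deriv_02 nabla g X Y Z = 0" if "X \<in> VF" "Y \<in> VF" "Z \<in> VF" for X Y Z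
    using that D_g[OF that(2,3,1)] g_commute[of Y \<xi>] g_commute[of Y "V X"]
    by (simp add: cov_deriv_02_def nabla_def g_\<xi>) (simp add: pointwise algebra_simps)
qed

text \<open>Since \<open>nabla \<xi> = V\<close> and \<open>nabla\<close> is torsion-free, \<open>R(X,Y) \<xi> = (nabla\<^sub>X V) Y - (nabla\<^sub>Y V) X\<close>, and
  the contributions of \<open>g(V X, V Y) \<xi>\<close> to the two terms cancel.\<close>

lemma curvature_nabla_\<xi>:
  assumes "X \<in> VF" "Y \<in> VF"
  shows "curvature nabla X Y \<xi>
    = \<eta> X \<odot> (V' Y + V (V Y) + P (V Y) - V (P Y)) - \<eta> Y \<odot> (V' X + V (V X) + P (V X) - V (P X))"
proof -
  note [simp] = tensor_11_simps[OF tensor_V] tensor_11_simps[OF tensor_P]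
    tensor_02_simps[OF tensor_g] D_simps
  have "nabla Z \<xi> = V Z" if "Z \<in> VF" for Z
    using that g_commute[of "V Z" \<xi>]
    by (simp add: nabla_def D_\<xi> V_\<xi> P_\<xi> g_\<xi> \<eta>_V)
  then have "curvature nabla X Y \<xi> = nabla X (V Y) - nabla Y (V X) - V (lie_bracket X Y)"
    using assms by (simp add: curvature_def)
  with assms g_commute[of "V X" "V Y"] show ?thesis
    by (simp add: nabla_def lie_bracket_torsion D_V \<eta>_V V_\<xi>) (simp add: pointwise algebra_simps)
qed

lemma kappa_mu_condition_nabla:
  assumes "\<And>X. X \<in> VF \<Longrightarrow>
    V' X + V (V X) + P (V X) - V (P X) = (- \<kappa>) \<cdot> (X - \<eta> X \<odot> \<xi>) - \<mu> \<cdot> half_lie \<xi> \<phi> X"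
  shows "kappa_mu_condition A \<phi> \<xi> \<eta> g \<kappa> \<mu>"
  unfolding kappa_mu_condition_def
proof (intro exI conjI ballI)
  fix X Y assume "X \<in> VF" "Y \<in> VF"
  then show "curvature nabla X Y \<xi> = \<kappa> \<cdot> (\<eta> Y \<odot> X - \<eta> X \<odot> Y)
      + \<mu> \<cdot> (\<eta> Y \<odot> half_lie \<xi> \<phi> X - \<eta> X \<odot> half_lie \<xi> \<phi> Y)"
    by (simp only: curvature_nabla_\<xi> assms) (simp add: pointwise algebra_simps)
qed (rule levi_civita_nabla)

end

end

section \<open>Integrable almost bi-paracontact structures\<close>

lemma square_zero_imp_zero:
  fixes u :: "'a \<Rightarrow> real"
  assumes "u * u = 0"
  shows "u = 0"
  using assms by (simp add: pointwise)

context contact_form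
begin

text \<open>Evaluating \<open>\<phi>\<^sup>3\<close> in two ways shows that \<open>\<phi> \<xi> = u \<xi>\<close> with \<open>u = \<eta> (\<phi> \<xi>)\<close>, and
  \<open>u\<^sup>2 \<xi> = \<phi>\<^sup>2 \<xi> = 0\<close> forces \<open>u = 0\<close>.\<close>

lemma
  assumes \<phi>: "tensor_11 A \<phi>" and sq: "\<And>X. X \<in> VF \<Longrightarrow> \<phi> (\<phi> X) = X - \<eta> X \<odot> \<xi>"
  shows paracontact_\<xi>: "\<phi> \<xi> = 0" and paracontact_\<eta>: "X \<in> VF \<Longrightarrow> \<eta> (\<phi> X) = 0"
proof -
  note [simp] = tensor_11_simps[OF \<phi>]
  have cube: "\<eta> (\<phi> X) \<odot> \<xi> = \<eta> X \<odot> \<phi> \<xi>" if "X \<in> VF" for X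
    using arg_cong[OF sq[OF that], of \<phi>] sq[of "\<phi> X"] that by simp
  have "\<phi> \<xi> = \<eta> (\<phi> \<xi>) \<odot> \<xi>"
    using cube[of \<xi>] by (simp add: pointwise)
  then have "\<eta> (\<phi> \<xi>) \<odot> \<eta> (\<phi> \<xi>) \<odot> \<xi> = \<phi> (\<phi> \<xi>)"
    by (metis \<phi> \<eta>_simps(1) \<xi>_VF tensor_11_VF tensor_11_fscale)
  also have "\<dots> = 0"
    using sq[of \<xi>] by (simp add: pointwise)
  finally have "\<eta> (\<eta> (\<phi> \<xi>) \<odot> \<eta> (\<phi> \<xi>) \<odot> \<xi>) = \<eta> 0"
    by (rule arg_cong)
  then have "\<eta> (\<phi> \<xi>) = 0"
    using square_zero_imp_zero[of "\<eta> (\<phi> \<xi>)"] by simp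
  with \<open>\<phi> \<xi> = \<eta> (\<phi> \<xi>) \<odot> \<xi>\<close> show \<phi>\<xi>: "\<phi> \<xi> = 0"
    by (metis fscale_0(1))
  show "\<eta> (\<phi> X) = 0" if "X \<in> VF"
  proof -
    have "\<eta> (\<eta> (\<phi> X) \<odot> \<xi>) = \<eta> 0"
      using cube[OF that] by (intro arg_cong[of _ 0 \<eta>]) (simp add: \<phi>\<xi>)
    with that show ?thesis
      by simp
  qed
qed

text \<open>\<open>X + \<phi> X\<close> and \<open>Y + \<phi> Y\<close> are sections of the \<open>1\<close>-eigendistribution, \<open>X - \<phi> X\<close> and \<open>Y - \<phi> Y\<close>
  of the other one. With \<open>\<alpha> = [X, Y] + [\<phi> X, \<phi> Y]\<close> and \<open>\<beta> = [\<phi> X, Y] + [X, \<phi> Y]\<close>, the brackets of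
  these pairs are \<open>\<alpha> + \<beta>\<close> and \<open>\<alpha> - \<beta>\<close>. By involutivity the first is fixed and the second negated
  by \<open>\<phi>\<close>, hence \<open>\<phi> \<beta> = \<alpha>\<close>; both brackets are in \<open>\<D>\<close>, hence \<open>\<eta> \<alpha> = 0\<close>.\<close>

lemma
  assumes \<phi>: "tensor_11 A \<phi>" and sq: "\<And>X. X \<in> VF \<Longrightarrow> \<phi> (\<phi> X) = X - \<eta> X \<odot> \<xi>"
    and leg: "\<And>r. r \<in> {1, -1} \<Longrightarrow> legendre_foliation A n \<eta> (eigendistribution A \<phi> r)"
    and X: "X \<in> VF" "\<eta> X = 0" and Y: "Y \<in> VF" "\<eta> Y = 0"
  shows legendre_nijenhuis: "nijenhuis \<phi> X Y = 2 \<cdot> d\<eta> X Y \<odot> \<xi>"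
    and legendre_d\<eta>: "d\<eta> (\<phi> X) (\<phi> Y) = - d\<eta> X Y"
proof -
  note [simp] = tensor_11_simps[OF \<phi>] paracontact_\<eta>[OF \<phi> sq]
  note [simp] = lie_bracket_add lie_bracket_diff lie_bracket_uminus X Y
  have plus: "Z + \<phi> Z \<in> eigendistribution A \<phi> 1" if "Z \<in> VF" "\<eta> Z = 0" for Z
    using that by (simp add: eigendistribution_def sq) (simp add: pointwise)
  have minus: "Z - \<phi> Z \<in> eigendistribution A \<phi> (-1)" if "Z \<in> VF" "\<eta> Z = 0" for Z
    using that by (simp add: eigendistribution_def sq) (simp add: pointwise)
  define \<alpha> \<beta> where "\<alpha> = lie_bracket X Y + lie_bracket (\<phi> X) (\<phi> Y)"
    and "\<beta> = lie_bracket (\<phi> X) Y + lie_bracket X (\<phi> Y)"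
  have VF: "\<alpha> \<in> VF" "\<beta> \<in> VF"
    by (simp_all add: \<alpha>_def \<beta>_def)
  have "lie_bracket (X + \<phi> X) (Y + \<phi> Y) \<in> eigendistribution A \<phi> 1"
    using leg[of 1] plus[OF X] plus[OF Y] unfolding legendre_foliation_def by blast
  moreover have "lie_bracket (X + \<phi> X) (Y + \<phi> Y) = \<alpha> + \<beta>"
    by (simp add: \<alpha>_def \<beta>_def)
  ultimately have p: "\<alpha> + \<beta> \<in> eigendistribution A \<phi> 1"
    by simp
  have "lie_bracket (X - \<phi> X) (Y - \<phi> Y) \<in> eigendistribution A \<phi> (-1)"
    using leg[of "-1"] minus[OF X] minus[OF Y] unfolding legendre_foliation_def by blast
  moreover have "lie_bracket (X - \<phi> X) (Y - \<phi> Y) = \<alpha> - \<beta>"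
    by (simp add: \<alpha>_def \<beta>_def)
  ultimately have m: "\<alpha> - \<beta> \<in> eigendistribution A \<phi> (-1)"
    by simp
  have "\<eta> (\<alpha> + \<beta>) = 0" "\<eta> (\<alpha> - \<beta>) = 0"
    using p m leg[of 1] leg[of "-1"] by (auto simp: legendre_foliation_def contact_distribution_def)
  then have \<eta>\<alpha>: "\<eta> \<alpha> = 0"
    using VF by simp (simp add: pointwise)
  then show "d\<eta> (\<phi> X) (\<phi> Y) = - d\<eta> X Y"
    using d\<eta>_contact_distribution[of X Y] d\<eta>_contact_distribution[of "\<phi> X" "\<phi> Y"]
    by (simp add: \<alpha>_def) (simp add: pointwise)
  have "\<phi> \<alpha> + \<phi> \<beta> = \<alpha> + \<beta>" "\<phi> \<alpha> - \<phi> \<beta> = \<beta> - \<alpha>"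
    using p m VF by (simp_all add: eigendistribution_def) (simp_all add: pointwise)
  then have "\<phi> \<beta> = \<alpha>"
    by (simp add: pointwise) (smt (verit))
  moreover have "nijenhuis \<phi> X Y = - \<eta> (lie_bracket X Y) \<odot> \<xi> + \<alpha> - \<phi> \<beta>"
    by (simp add: nijenhuis_def sq \<alpha>_def \<beta>_def) (simp add: pointwise)
  ultimately show "nijenhuis \<phi> X Y = 2 \<cdot> d\<eta> X Y \<odot> \<xi>"
    by (simp add: d\<eta>_contact_distribution) (simp add: pointwise)
qed

lemma nijenhuis_\<xi>:
  assumes "tensor_11 A \<phi>" "\<phi> \<xi> = 0" "X \<in> VF"
  shows "nijenhuis \<phi> \<xi> X = (- 2) \<cdot> \<phi> (half_lie \<xi> \<phi> X)"
  using assms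
  by (simp add: nijenhuis_def half_lie_def tensor_11_simps[OF assms(1)] tensor_11_0[OF assms(1) \<xi>_VF] lie_bracket_0)
     (simp add: pointwise)

end

locale integrable_bi_paracontact = contact_form A \<eta> \<xi>
  for A :: "('a::{t2_space,second_countable_topology}, 'e::euclidean_space) atlas"
    and \<eta> :: "'a vfield \<Rightarrow> 'a \<Rightarrow> real" and \<xi> :: "'a vfield" +
  fixes n and \<phi>\<^sub>1 \<phi>\<^sub>2 \<phi>\<^sub>3 :: "'a vfield \<Rightarrow> 'a vfield"
  assumes integrable: "integrable_almost_bi_paracontact A n \<eta> \<xi> \<phi>\<^sub>1 \<phi>\<^sub>2 \<phi>\<^sub>3"
begin

lemma tensor_\<phi>: "tensor_11 A \<phi>\<^sub>1" "tensor_11 A \<phi>\<^sub>2" "tensor_11 A \<phi>\<^sub>3"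
  and \<phi>\<^sub>1_\<phi>\<^sub>1 [simp]: "X \<in> VF \<Longrightarrow> \<phi>\<^sub>1 (\<phi>\<^sub>1 X) = X - \<eta> X \<odot> \<xi>"
  and \<phi>\<^sub>2_\<phi>\<^sub>2 [simp]: "X \<in> VF \<Longrightarrow> \<phi>\<^sub>2 (\<phi>\<^sub>2 X) = X - \<eta> X \<odot> \<xi>"
  and \<phi>\<^sub>3_\<phi>\<^sub>3 [simp]: "X \<in> VF \<Longrightarrow> \<phi>\<^sub>3 (\<phi>\<^sub>3 X) = - X + \<eta> X \<odot> \<xi>"
  and \<phi>\<^sub>1_\<phi>\<^sub>2 [simp]: "X \<in> VF \<Longrightarrow> \<phi>\<^sub>1 (\<phi>\<^sub>2 X) = \<phi>\<^sub>3 X"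
  and \<phi>\<^sub>3_alt: "X \<in> VF \<Longrightarrow> \<phi>\<^sub>3 X = - \<phi>\<^sub>2 (\<phi>\<^sub>1 X)"
  and leg: "\<And>r. r \<in> {1, -1} \<Longrightarrow> legendre_foliation A n \<eta> (eigendistribution A \<phi>\<^sub>1 r)"
    "\<And>r. r \<in> {1, -1} \<Longrightarrow> legendre_foliation A n \<eta> (eigendistribution A \<phi>\<^sub>2 r)"
  using integrable by (auto simp: integrable_almost_bi_paracontact_def almost_bi_paracontact_def)

lemmas \<phi>_simps [simp] =
  tensor_11_simps[OF tensor_\<phi>(1)] tensor_11_simps[OF tensor_\<phi>(2)] tensor_11_simps[OF tensor_\<phi>(3)]

lemmas \<phi>_\<xi>12 = paracontact_\<xi>[OF tensor_\<phi>(1) \<phi>\<^sub>1_\<phi>\<^sub>1] paracontact_\<xi>[OF tensor_\<phi>(2) \<phi>\<^sub>2_\<phi>\<^sub>2]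
lemmas \<eta>_\<phi>12 = paracontact_\<eta>[OF tensor_\<phi>(1) \<phi>\<^sub>1_\<phi>\<^sub>1] paracontact_\<eta>[OF tensor_\<phi>(2) \<phi>\<^sub>2_\<phi>\<^sub>2]

lemma \<phi>_\<xi> [simp]: "\<phi>\<^sub>1 \<xi> = 0" "\<phi>\<^sub>2 \<xi> = 0" "\<phi>\<^sub>3 \<xi> = 0"
  and \<phi>_0 [simp]: "\<phi>\<^sub>1 0 = 0" "\<phi>\<^sub>2 0 = 0" "\<phi>\<^sub>3 0 = 0"
proof -
  show "\<phi>\<^sub>1 0 = 0" "\<phi>\<^sub>2 0 = 0" "\<phi>\<^sub>3 0 = 0"
    using tensor_11_0[OF _ \<xi>_VF] tensor_\<phi> by auto
  then show "\<phi>\<^sub>1 \<xi> = 0" "\<phi>\<^sub>2 \<xi> = 0" "\<phi>\<^sub>3 \<xi> = 0"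
    using \<phi>_\<xi>12 \<phi>\<^sub>1_\<phi>\<^sub>2[of \<xi>] by auto
qed

lemma \<eta>_\<phi> [simp]: "X \<in> VF \<Longrightarrow> \<eta> (\<phi>\<^sub>1 X) = 0" "X \<in> VF \<Longrightarrow> \<eta> (\<phi>\<^sub>2 X) = 0" "X \<in> VF \<Longrightarrow> \<eta> (\<phi>\<^sub>3 X) = 0"
  using \<eta>_\<phi>12 \<eta>_\<phi>12(1)[of "\<phi>\<^sub>2 X"] by auto

lemma \<phi>_products [simp]:
  assumes "X \<in> VF"
  shows "\<phi>\<^sub>2 (\<phi>\<^sub>1 X) = - \<phi>\<^sub>3 X" "\<phi>\<^sub>1 (\<phi>\<^sub>3 X) = \<phi>\<^sub>2 X" "\<phi>\<^sub>3 (\<phi>\<^sub>1 X) = - \<phi>\<^sub>2 X"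
    "\<phi>\<^sub>2 (\<phi>\<^sub>3 X) = - \<phi>\<^sub>1 X" "\<phi>\<^sub>3 (\<phi>\<^sub>2 X) = \<phi>\<^sub>1 X"
proof -
  have 21: "\<phi>\<^sub>2 (\<phi>\<^sub>1 X) = - \<phi>\<^sub>3 X" if "X \<in> VF" for X
    using \<phi>\<^sub>3_alt[OF that] by simp
  show 13: "\<phi>\<^sub>1 (\<phi>\<^sub>3 X) = \<phi>\<^sub>2 X"
    using \<phi>\<^sub>1_\<phi>\<^sub>1[of "\<phi>\<^sub>2 X"] assms by simp
  show "\<phi>\<^sub>3 (\<phi>\<^sub>2 X) = \<phi>\<^sub>1 X"
    using \<phi>\<^sub>1_\<phi>\<^sub>2[of "\<phi>\<^sub>2 X"] assms by simp
  show "\<phi>\<^sub>3 (\<phi>\<^sub>1 X) = - \<phi>\<^sub>2 X"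
    using \<phi>\<^sub>1_\<phi>\<^sub>2[of "\<phi>\<^sub>1 X"] assms 21[of X] 13 by simp
  show "\<phi>\<^sub>2 (\<phi>\<^sub>1 X) = - \<phi>\<^sub>3 X"
    using assms by (rule 21)
  show "\<phi>\<^sub>2 (\<phi>\<^sub>3 X) = - \<phi>\<^sub>1 X"
    using 21[of "\<phi>\<^sub>2 X"] assms \<phi>\<^sub>1_\<phi>\<^sub>2[of "\<phi>\<^sub>2 X"] by simp
qed

text \<open>For \<open>\<phi>\<^sub>1\<close> and \<open>\<phi>\<^sub>2\<close> this says that the eigendistributions are isotropic; \<open>\<phi>\<^sub>3\<close> is the product
  of two anticommuting skew operators.\<close>

lemma d\<eta>_\<phi> [simp]:
  assumes "X \<in> VF" "Y \<in> VF"
  shows "d\<eta> (\<phi>\<^sub>1 X) Y = - d\<eta> X (\<phi>\<^sub>1 Y)" "d\<eta> (\<phi>\<^sub>2 X) Y = - d\<eta> X (\<phi>\<^sub>2 Y)"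
    "d\<eta> (\<phi>\<^sub>3 X) Y = - d\<eta> X (\<phi>\<^sub>3 Y)"
proof -
  have *: "d\<eta> (\<phi> X) Y = - d\<eta> X (\<phi> Y)"
    if \<phi>: "tensor_11 A \<phi>" and sq: "\<And>X. X \<in> VF \<Longrightarrow> \<phi> (\<phi> X) = X - \<eta> X \<odot> \<xi>"
      and leg: "\<And>r. r \<in> {1, -1} \<Longrightarrow> legendre_foliation A n \<eta> (eigendistribution A \<phi> r)"
      and "X \<in> VF" "Y \<in> VF" for \<phi> X Y
  proof -
    note [simp] = tensor_11_simps[OF \<phi>] paracontact_\<xi>[OF \<phi> sq] paracontact_\<eta>[OF \<phi> sq]
    have "d\<eta> (\<phi> (X - \<eta> X \<odot> \<xi>)) (\<phi> (\<phi> Y)) = - d\<eta> (X - \<eta> X \<odot> \<xi>) (\<phi> Y)"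
      using that by (intro legendre_d\<eta>[OF \<phi> sq leg]) auto
    with that show ?thesis
      by (simp add: sq)
  qed
  have 1: "d\<eta> (\<phi>\<^sub>1 X) Y = - d\<eta> X (\<phi>\<^sub>1 Y)" if "X \<in> VF" "Y \<in> VF" for X Y
    using *[OF tensor_\<phi>(1) \<phi>\<^sub>1_\<phi>\<^sub>1 leg(1) that] by simp
  have 2: "d\<eta> (\<phi>\<^sub>2 X) Y = - d\<eta> X (\<phi>\<^sub>2 Y)" if "X \<in> VF" "Y \<in> VF" for X Y
    using *[OF tensor_\<phi>(2) \<phi>\<^sub>2_\<phi>\<^sub>2 leg(2) that] by simp
  show "d\<eta> (\<phi>\<^sub>1 X) Y = - d\<eta> X (\<phi>\<^sub>1 Y)" "d\<eta> (\<phi>\<^sub>2 X) Y = - d\<eta> X (\<phi>\<^sub>2 Y)"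
    using assms by (rule 1 2)+
  show "d\<eta> (\<phi>\<^sub>3 X) Y = - d\<eta> X (\<phi>\<^sub>3 Y)"
    using 1[of "\<phi>\<^sub>2 X" Y] 2[of X "\<phi>\<^sub>1 Y"] assms by simp
qed

end

locale canonical_bi_paracontact = integrable_bi_paracontact A \<eta> \<xi> n \<phi>\<^sub>1 \<phi>\<^sub>2 \<phi>\<^sub>3
  for A :: "('a::{t2_space,second_countable_topology}, 'e::euclidean_space) atlas"
    and \<eta> :: "'a vfield \<Rightarrow> 'a \<Rightarrow> real" and \<xi> :: "'a vfield"
    and n and \<phi>\<^sub>1 \<phi>\<^sub>2 \<phi>\<^sub>3 :: "'a vfield \<Rightarrow> 'a vfield" +
  fixes Dc :: "'a vfield \<Rightarrow> 'a vfield \<Rightarrow> 'a vfield" and a b :: real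
  assumes canonical: "canonical_connection A \<eta> \<xi> \<phi>\<^sub>1 \<phi>\<^sub>2 \<phi>\<^sub>3 Dc"
    and Dc_d\<eta>: "\<And>X Y Z. X \<in> VF \<Longrightarrow> Y \<in> VF \<Longrightarrow> Z \<in> VF \<Longrightarrow> cov_deriv_02 Dc d\<eta> X Y Z = 0"
    and Dc_\<phi>: "cov_deriv_eq A \<eta> Dc \<phi>\<^sub>1 (\<lambda>Y. (- a) \<cdot> \<phi>\<^sub>2 Y)"
      "cov_deriv_eq A \<eta> Dc \<phi>\<^sub>2 (\<lambda>Y. a \<cdot> \<phi>\<^sub>1 Y + b \<cdot> \<phi>\<^sub>3 Y)"
      "cov_deriv_eq A \<eta> Dc \<phi>\<^sub>3 (\<lambda>Y. b \<cdot> \<phi>\<^sub>2 Y)"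
begin

lemma connection_Dc: "linear_connection A Dc"
  using canonical by (simp add: canonical_connection_def)

lemmas Dc_simps [simp] = linear_connection_simps[OF connection_Dc]

lemma Dc_\<phi>_commute:
  assumes "X \<in> VF" "Y \<in> VF"
  shows "Dc X (\<phi>\<^sub>1 Y) = \<phi>\<^sub>1 (Dc X Y) + (- a) \<cdot> \<eta> X \<odot> \<phi>\<^sub>2 Y"
    and "Dc X (\<phi>\<^sub>2 Y) = \<phi>\<^sub>2 (Dc X Y) + a \<cdot> \<eta> X \<odot> \<phi>\<^sub>1 Y + b \<cdot> \<eta> X \<odot> \<phi>\<^sub>3 Y"
    and "Dc X (\<phi>\<^sub>3 Y) = \<phi>\<^sub>3 (Dc X Y) + b \<cdot> \<eta> X \<odot> \<phi>\<^sub>2 Y"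
  using Dc_\<phi> assms
  by (auto simp: cov_deriv_eq_def cov_deriv_11_def pointwise algebra_simps)

lemma Dc_\<xi> [simp]: "X \<in> VF \<Longrightarrow> Dc X \<xi> = 0"
  using canonical by (simp add: canonical_connection_def)

text \<open>\<open>\<phi>\<^sub>1\<^sup>2 = I - \<eta> \<otimes> \<xi>\<close> is parallel, since \<open>\<nabla>\<^sup>c \<phi>\<^sub>1\<close> is a multiple of \<open>\<phi>\<^sub>2\<close>, which anticommutes with
  \<open>\<phi>\<^sub>1\<close>; and so is \<open>\<xi>\<close>.\<close>

lemma Dc_\<eta>:
  assumes "X \<in> VF" "Y \<in> VF"
  shows "\<eta> (Dc X Y) = X (\<eta> Y)"
proof -
  have "Dc X (\<phi>\<^sub>1 (\<phi>\<^sub>1 Y)) = \<phi>\<^sub>1 (\<phi>\<^sub>1 (Dc X Y))"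
    using assms by (simp add: Dc_\<phi>_commute del: \<phi>\<^sub>1_\<phi>\<^sub>1) (simp add: pointwise)
  moreover have "Dc X (Y - \<eta> Y \<odot> \<xi>) = Dc X Y - X (\<eta> Y) \<odot> \<xi>"
    using assms by simp
  ultimately have "X (\<eta> Y) \<odot> \<xi> = \<eta> (Dc X Y) \<odot> \<xi>"
    using assms by simp
  then have "\<eta> (X (\<eta> Y) \<odot> \<xi>) = \<eta> (\<eta> (Dc X Y) \<odot> \<xi>)"
    by (rule arg_cong)
  with assms show ?thesis
    by simp
qed

lemma torsion_VF [simp]: "X \<in> VF \<Longrightarrow> Y \<in> VF \<Longrightarrow> torsion Dc X Y \<in> VF"
  by (simp add: torsion_def)

text \<open>Comparison of the two expressions for \<open>\<nabla>\<^sup>c\<^sub>\<xi> \<phi>\<^sub>\<alpha>\<close> determines \<open>h\<^sub>\<alpha>\<close>.\<close>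

lemma half_lie_\<phi>:
  assumes "Y \<in> VF"
  shows "half_lie \<xi> \<phi>\<^sub>1 Y = (- 3/2 * a) \<cdot> \<phi>\<^sub>2 Y"
    and "half_lie \<xi> \<phi>\<^sub>2 Y = (3/2 * a) \<cdot> \<phi>\<^sub>1 Y + (3/2 * b) \<cdot> \<phi>\<^sub>3 Y"
    and "half_lie \<xi> \<phi>\<^sub>3 Y = (3/2 * b) \<cdot> \<phi>\<^sub>2 Y"
proof -
  have *: "half_lie \<xi> \<phi> Y = (3/2) \<cdot> B Y"
    if "\<phi> \<in> {\<phi>\<^sub>1, \<phi>\<^sub>2, \<phi>\<^sub>3}" "cov_deriv_eq A \<eta> Dc \<phi> B" for \<phi> B
  proof -
    have "cov_deriv_eq A \<eta> Dc \<phi> (\<lambda>Y. (2/3) \<cdot> half_lie \<xi> \<phi> Y)"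
      using canonical that(1) unfolding canonical_connection_def by blast
    then have "\<eta> \<xi> \<odot> B Y = \<eta> \<xi> \<odot> (2/3) \<cdot> half_lie \<xi> \<phi> Y"
      using that(2) assms unfolding cov_deriv_eq_def by (metis \<xi>_VF)
    then have "B Y = (2/3) \<cdot> half_lie \<xi> \<phi> Y"
      by simp
    then show ?thesis
      by (simp only:) (simp add: pointwise)
  qed
  show "half_lie \<xi> \<phi>\<^sub>1 Y = (- 3/2 * a) \<cdot> \<phi>\<^sub>2 Y"
    using *[OF _ Dc_\<phi>(1)] by (simp add: pointwise)
  show "half_lie \<xi> \<phi>\<^sub>2 Y = (3/2 * a) \<cdot> \<phi>\<^sub>1 Y + (3/2 * b) \<cdot> \<phi>\<^sub>3 Y"
    using *[OF _ Dc_\<phi>(2)] by (simp add: pointwise algebra_simps)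
  show "half_lie \<xi> \<phi>\<^sub>3 Y = (3/2 * b) \<cdot> \<phi>\<^sub>2 Y"
    using *[OF _ Dc_\<phi>(3)] by (simp add: pointwise)
qed

text \<open>On \<open>\<D>\<close> the Nijenhuis tensors of \<open>\<phi>\<^sub>1\<close> and \<open>\<phi>\<^sub>2\<close> do not contribute to the torsion, so that
  \<open>T = 2 d\<eta> \<otimes> \<xi> + N / 6\<close> with \<open>N = [\<phi>\<^sub>3, \<phi>\<^sub>3] + 2 d\<eta> \<otimes> \<xi>\<close>. On the other hand, \<open>\<phi>\<^sub>3\<close> is parallel in
  the directions of \<open>\<D>\<close>, so \<open>[\<phi>\<^sub>3, \<phi>\<^sub>3]\<close> can be computed from \<open>T\<close>. The result is \<open>N = (2/3) N\<close>.\<close>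

lemma torsion_on_contact_distribution:
  assumes "X \<in> VF" "\<eta> X = 0" "Y \<in> VF" "\<eta> Y = 0"
  shows "torsion Dc X Y = 2 \<cdot> d\<eta> X Y \<odot> \<xi>"
proof -
  define N where "N X Y = nijenhuis \<phi>\<^sub>3 X Y + 2 \<cdot> d\<eta> X Y \<odot> \<xi>" for X Y
  have T: "torsion Dc X Y = 2 \<cdot> d\<eta> X Y \<odot> \<xi> + (1/6) \<cdot> N X Y"
    if "X \<in> VF" "\<eta> X = 0" "Y \<in> VF" "\<eta> Y = 0" for X Y
  proof -
    have "torsion Dc X Y = d\<eta> X Y \<odot> \<xi>
        + (1/3) \<cdot> (- d\<eta> (\<phi>\<^sub>1 X) (\<phi>\<^sub>1 Y) - d\<eta> (\<phi>\<^sub>2 X) (\<phi>\<^sub>2 Y) + d\<eta> (\<phi>\<^sub>3 X) (\<phi>\<^sub>3 Y)) \<odot> \<xi>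
        + (1/6) \<cdot> (- N1 1 \<eta> \<xi> \<phi>\<^sub>1 X Y - N1 1 \<eta> \<xi> \<phi>\<^sub>2 X Y + N1 (-1) \<eta> \<xi> \<phi>\<^sub>3 X Y)"
      using canonical that by (simp add: canonical_connection_def)
    moreover have "nijenhuis \<phi>\<^sub>1 X Y = 2 \<cdot> d\<eta> X Y \<odot> \<xi>" "nijenhuis \<phi>\<^sub>2 X Y = 2 \<cdot> d\<eta> X Y \<odot> \<xi>"
      using legendre_nijenhuis[OF tensor_\<phi>(1) \<phi>\<^sub>1_\<phi>\<^sub>1 leg(1)]
        legendre_nijenhuis[OF tensor_\<phi>(2) \<phi>\<^sub>2_\<phi>\<^sub>2 leg(2)] that by blast+
    ultimately show ?thesis
      using that by (simp add: N1_def N_def)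
         (simp add: pointwise algebra_simps)
  qed
  have N_VF: "N X Y \<in> VF" if "X \<in> VF" "Y \<in> VF" for X Y
    using that by (simp add: N_def nijenhuis_def)
  define \<alpha> \<beta> \<gamma> \<delta> where "\<alpha> = lie_bracket X Y" and "\<beta> = lie_bracket (\<phi>\<^sub>3 X) Y"
    and "\<gamma> = lie_bracket X (\<phi>\<^sub>3 Y)" and "\<delta> = lie_bracket (\<phi>\<^sub>3 X) (\<phi>\<^sub>3 Y)"
  have [simp]: "\<alpha> \<in> VF" "\<beta> \<in> VF" "\<gamma> \<in> VF" "\<delta> \<in> VF"
    using assms by (auto simp: \<alpha>_def \<beta>_def \<gamma>_def \<delta>_def)
  have \<eta>_brackets: "\<eta> \<alpha> = (\<lambda>_. - 2) * d\<eta> X Y" "\<eta> \<beta> = (\<lambda>_. 2) * d\<eta> X (\<phi>\<^sub>3 Y)"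
    "\<eta> \<gamma> = (\<lambda>_. - 2) * d\<eta> X (\<phi>\<^sub>3 Y)" "\<eta> \<delta> = (\<lambda>_. - 2) * d\<eta> X Y"
    using assms by (auto simp: \<alpha>_def \<beta>_def \<gamma>_def \<delta>_def d\<eta>_contact_distribution)
      (simp_all add: pointwise)
  have N: "N X Y = - \<alpha> + \<delta> - \<phi>\<^sub>3 (\<beta> + \<gamma>)"
    "N (\<phi>\<^sub>3 X) Y = - \<beta> - \<gamma> + \<phi>\<^sub>3 (\<alpha> - \<delta>)"
    "N X (\<phi>\<^sub>3 Y) = - \<beta> - \<gamma> + \<phi>\<^sub>3 (\<alpha> - \<delta>)"
    "N (\<phi>\<^sub>3 X) (\<phi>\<^sub>3 Y) = \<alpha> - \<delta> + \<phi>\<^sub>3 (\<beta> + \<gamma>)"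
    using assms \<eta>_brackets
    by (simp_all add: N_def nijenhuis_def \<alpha>_def[symmetric] \<beta>_def[symmetric] \<gamma>_def[symmetric]
        \<delta>_def[symmetric] lie_bracket_uminus)
       (simp_all add: pointwise)
  have tor: "\<alpha> = Dc X Y - Dc Y X - torsion Dc X Y"
    "\<beta> = Dc (\<phi>\<^sub>3 X) Y - \<phi>\<^sub>3 (Dc Y X) - torsion Dc (\<phi>\<^sub>3 X) Y"
    "\<gamma> = \<phi>\<^sub>3 (Dc X Y) - Dc (\<phi>\<^sub>3 Y) X - torsion Dc X (\<phi>\<^sub>3 Y)"
    "\<delta> = \<phi>\<^sub>3 (Dc (\<phi>\<^sub>3 X) Y) - \<phi>\<^sub>3 (Dc (\<phi>\<^sub>3 Y) X) - torsion Dc (\<phi>\<^sub>3 X) (\<phi>\<^sub>3 Y)"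
    using assms by (simp_all add: \<alpha>_def \<beta>_def \<gamma>_def \<delta>_def torsion_def Dc_\<phi>_commute)
  have "N X Y = torsion Dc X Y - torsion Dc (\<phi>\<^sub>3 X) (\<phi>\<^sub>3 Y)
      + \<phi>\<^sub>3 (torsion Dc (\<phi>\<^sub>3 X) Y + torsion Dc X (\<phi>\<^sub>3 Y))"
    using assms by (simp add: N(1) tor Dc_\<eta>)
  also have "\<dots> = (1/6) \<cdot> (N X Y - N (\<phi>\<^sub>3 X) (\<phi>\<^sub>3 Y) + \<phi>\<^sub>3 (N (\<phi>\<^sub>3 X) Y + N X (\<phi>\<^sub>3 Y)))"
    using assms T[of X Y] T[of "\<phi>\<^sub>3 X" Y] T[of X "\<phi>\<^sub>3 Y"] T[of "\<phi>\<^sub>3 X" "\<phi>\<^sub>3 Y"] N_VF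
    by simp (simp add: pointwise algebra_simps)
  also have "N (\<phi>\<^sub>3 X) (\<phi>\<^sub>3 Y) = - N X Y"
    by (simp add: N(1,4))
  also have "\<phi>\<^sub>3 (N (\<phi>\<^sub>3 X) Y + N X (\<phi>\<^sub>3 Y)) = 2 \<cdot> N X Y"
  proof -
    have "\<phi>\<^sub>3 (N (\<phi>\<^sub>3 X) Y) = N X Y"
      using \<eta>_brackets by (simp add: N(1,2))
    moreover have "N X (\<phi>\<^sub>3 Y) = N (\<phi>\<^sub>3 X) Y"
      by (simp add: N(2,3))
    moreover have "\<phi>\<^sub>3 (N (\<phi>\<^sub>3 X) Y + N X (\<phi>\<^sub>3 Y)) = \<phi>\<^sub>3 (N (\<phi>\<^sub>3 X) Y) + \<phi>\<^sub>3 (N X (\<phi>\<^sub>3 Y))"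
      using assms N_VF by simp
    ultimately show ?thesis
      by (simp only:) (simp add: pointwise)
  qed
  finally have "N X Y = 0"
    by (simp add: pointwise)
  with T assms show ?thesis
    by (simp add: pointwise)
qed

text \<open>The components with \<open>\<xi>\<close> come from \<open>[\<phi>\<^sub>\<alpha>, \<phi>\<^sub>\<alpha>](\<xi>, Z) = - 2 \<phi>\<^sub>\<alpha> h\<^sub>\<alpha> Z\<close>:
  \<open>T(\<xi>, Z) = (1/3) (\<phi>\<^sub>1 h\<^sub>1 + \<phi>\<^sub>2 h\<^sub>2 - \<phi>\<^sub>3 h\<^sub>3) Z\<close>.\<close>

lemma torsion_Dc:
  assumes "X \<in> VF" "Y \<in> VF"
  shows "torsion Dc X Y = 2 \<cdot> d\<eta> X Y \<odot> \<xi>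
    - \<eta> X \<odot> (a \<cdot> \<phi>\<^sub>3 Y + b \<cdot> \<phi>\<^sub>1 Y) + \<eta> Y \<odot> (a \<cdot> \<phi>\<^sub>3 X + b \<cdot> \<phi>\<^sub>1 X)"
proof -
  have T\<xi>: "torsion Dc \<xi> Z = - (a \<cdot> \<phi>\<^sub>3 Z + b \<cdot> \<phi>\<^sub>1 Z)" if "Z \<in> VF" for Z
  proof -
    have "torsion Dc \<xi> Z = d\<eta> \<xi> Z \<odot> \<xi>
        + (1/3) \<cdot> (- d\<eta> (\<phi>\<^sub>1 \<xi>) (\<phi>\<^sub>1 Z) - d\<eta> (\<phi>\<^sub>2 \<xi>) (\<phi>\<^sub>2 Z) + d\<eta> (\<phi>\<^sub>3 \<xi>) (\<phi>\<^sub>3 Z)) \<odot> \<xi>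
        + (1/6) \<cdot> (- N1 1 \<eta> \<xi> \<phi>\<^sub>1 \<xi> Z - N1 1 \<eta> \<xi> \<phi>\<^sub>2 \<xi> Z + N1 (-1) \<eta> \<xi> \<phi>\<^sub>3 \<xi> Z)"
      using canonical that by (simp add: canonical_connection_def)
    with that show ?thesis
      by (simp add: N1_def nijenhuis_\<xi> tensor_\<phi> half_lie_\<phi>)
         (simp add: pointwise algebra_simps)
  qed
  have skew: "torsion Dc Z \<xi> = - torsion Dc \<xi> Z" for Z
    by (simp add: torsion_def lie_bracket_skew[of Z \<xi>])
  have "torsion Dc (X - \<eta> X \<odot> \<xi>) (Y - \<eta> Y \<odot> \<xi>)
      = torsion Dc X Y - \<eta> X \<odot> torsion Dc \<xi> Y - \<eta> Y \<odot> torsion Dc X \<xi>"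
    using assms
    by (simp add: torsion_def lie_bracket_diff lie_bracket_fscale)
       (simp add: pointwise algebra_simps)
  moreover have "torsion Dc (X - \<eta> X \<odot> \<xi>) (Y - \<eta> Y \<odot> \<xi>) = 2 \<cdot> d\<eta> X Y \<odot> \<xi>"
    using assms torsion_on_contact_distribution[of "X - \<eta> X \<odot> \<xi>" "Y - \<eta> Y \<odot> \<xi>"] by simp
  ultimately show ?thesis
    using assms by (simp add: skew T\<xi>) (simp add: pointwise algebra_simps)
qed

sublocale contact_connection A \<eta> \<xi> Dc "\<lambda>X. a \<cdot> \<phi>\<^sub>3 X + b \<cdot> \<phi>\<^sub>1 X"
proof
  show "tensor_11 A (\<lambda>X. a \<cdot> \<phi>\<^sub>3 X + b \<cdot> \<phi>\<^sub>1 X)"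
    by (simp add: tensor_11_def; simp add: pointwise algebra_simps)
qed (simp_all add: connection_Dc Dc_\<eta> torsion_Dc)

section \<open>The three metrics\<close>

abbreviation g\<^sub>1 where "g\<^sub>1 \<equiv> \<lambda>X Y. d\<eta> X (\<phi>\<^sub>1 Y) + \<eta> X * \<eta> Y"
abbreviation g\<^sub>2 where "g\<^sub>2 \<equiv> \<lambda>X Y. d\<eta> X (\<phi>\<^sub>2 Y) + \<eta> X * \<eta> Y"
abbreviation g\<^sub>3 where "g\<^sub>3 \<equiv> \<lambda>X Y. - d\<eta> X (\<phi>\<^sub>3 Y) + \<eta> X * \<eta> Y"

lemma d\<eta>_\<phi>_commute:
  assumes "X \<in> VF" "Y \<in> VF"
  shows "d\<eta> Y (\<phi>\<^sub>1 X) = d\<eta> X (\<phi>\<^sub>1 Y)" "d\<eta> Y (\<phi>\<^sub>2 X) = d\<eta> X (\<phi>\<^sub>2 Y)" "d\<eta> Y (\<phi>\<^sub>3 X) = d\<eta> X (\<phi>\<^sub>3 Y)"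
  using assms d\<eta>_skew[of "\<phi>\<^sub>1 X" Y] d\<eta>_skew[of "\<phi>\<^sub>2 X" Y] d\<eta>_skew[of "\<phi>\<^sub>3 X" Y] by simp_all

lemma symmetric_tensor_g: "symmetric_tensor A g\<^sub>1" "symmetric_tensor A g\<^sub>2" "symmetric_tensor A g\<^sub>3"
proof -
  have "tensor_02 A g\<^sub>1" "tensor_02 A g\<^sub>2" "tensor_02 A g\<^sub>3"
    unfolding tensor_02_def one_form_def
    by (intro conjI ballI; simp; simp add: pointwise algebra_simps)+
  then show "symmetric_tensor A g\<^sub>1" "symmetric_tensor A g\<^sub>2" "symmetric_tensor A g\<^sub>3"
    unfolding symmetric_tensor_def using d\<eta>_\<phi>_commute by (simp_all add: mult.commute)
qed

lemma Dc_d\<eta>_apply: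
  assumes "X \<in> VF" "Y \<in> VF" "Z \<in> VF"
  shows "X (d\<eta> Y Z) = d\<eta> (Dc X Y) Z + d\<eta> Y (Dc X Z)"
  using Dc_d\<eta>[OF assms] by (simp add: cov_deriv_02_def pointwise algebra_simps)

text \<open>The operator \<open>V\<close> is \<open>- \<phi>\<^sub>\<alpha> + \<epsilon> \<phi>\<^sub>\<alpha> h\<^sub>\<alpha>\<close>, where \<open>\<phi>\<^sub>\<alpha>\<^sup>2 = \<epsilon> (I - \<eta> \<otimes> \<xi>)\<close>: its skew part with respect
  to \<open>g\<^sub>\<alpha>\<close> has to represent \<open>d\<eta>\<close>, and its symmetric part is determined by \<open>\<nabla>\<^sup>c g\<^sub>\<alpha>\<close> and the
  symmetric part of \<open>P\<close>, the combination of those \<open>\<phi>\<^sub>\<beta>\<close> in \<open>P\<close> that anticommute with \<open>\<phi>\<^sub>\<alpha>\<close>.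
  \<open>V'\<close> is read off from \<open>\<nabla>\<^sup>c \<phi>\<^sub>\<beta>\<close>.\<close>

lemma kappa_mu_g\<^sub>1: "kappa_mu_condition A \<phi>\<^sub>1 \<xi> \<eta> g\<^sub>1 (9/4 * a\<^sup>2 - 1) (2 - 3 * b)"
proof -
  let ?P = "\<lambda>X. a \<cdot> \<phi>\<^sub>3 X + b \<cdot> \<phi>\<^sub>1 X"
  let ?V = "\<lambda>X. - \<phi>\<^sub>1 X - (3/2 * a) \<cdot> \<phi>\<^sub>3 X"
  let ?V' = "\<lambda>X. a \<cdot> \<phi>\<^sub>2 X - (3/2 * a * b) \<cdot> \<phi>\<^sub>2 X"
  show ?thesis
  proof (rule kappa_mu_condition_nabla[where V = ?V and V' = ?V'])
    show "tensor_11 A ?V"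
      by (simp add: tensor_11_def; simp add: pointwise field_simps)
    show "symmetric_tensor A g\<^sub>1"
      by (rule symmetric_tensor_g)
    show "g\<^sub>1 (?V X) Y - g\<^sub>1 (?V Y) X = (\<lambda>_. 2) * d\<eta> X Y" if "X \<in> VF" "Y \<in> VF" for X Y
      using that d\<eta>_\<phi>_commute[of X Y] d\<eta>_skew[of X Y]
      by simp (simp add: pointwise algebra_simps)
    show "cov_deriv_02 Dc g\<^sub>1 Z X Y = \<eta> Z * (g\<^sub>1 (?V X + ?P X) Y + g\<^sub>1 X (?V Y + ?P Y))"
      if "X \<in> VF" "Y \<in> VF" "Z \<in> VF" for X Y Z
      using that
      by (simp add: cov_deriv_02_def Dc_d\<eta>_apply Dc_\<phi>_commute Dc_\<eta>)
         (simp add: pointwise algebra_simps)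
    show "Dc X (?V Y) = ?V (Dc X Y) + \<eta> X \<odot> ?V' Y" if "X \<in> VF" "Y \<in> VF" for X Y
      using that by (simp add: Dc_\<phi>_commute) (simp add: pointwise algebra_simps)
    show "?V' X + ?V (?V X) + ?P (?V X) - ?V (?P X)
        = (- (9/4 * a\<^sup>2 - 1)) \<cdot> (X - \<eta> X \<odot> \<xi>) - (2 - 3 * b) \<cdot> half_lie \<xi> \<phi>\<^sub>1 X" if "X \<in> VF" for X
      using that
      by (simp add: half_lie_\<phi>) (simp add: pointwise field_simps power2_eq_square)
  qed simp_all
qed

lemma kappa_mu_g\<^sub>2: "kappa_mu_condition A \<phi>\<^sub>2 \<xi> \<eta> g\<^sub>2 (9/4 * (a\<^sup>2 - b\<^sup>2) - 1) (2)"
proof -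
  let ?P = "\<lambda>X. a \<cdot> \<phi>\<^sub>3 X + b \<cdot> \<phi>\<^sub>1 X"
  let ?V = "\<lambda>X. - \<phi>\<^sub>2 X - (3/2 * a) \<cdot> \<phi>\<^sub>3 X - (3/2 * b) \<cdot> \<phi>\<^sub>1 X"
  let ?V' = "\<lambda>X. - (a \<cdot> \<phi>\<^sub>1 X + b \<cdot> \<phi>\<^sub>3 X)"
  show ?thesis
  proof (rule kappa_mu_condition_nabla[where V = ?V and V' = ?V'])
    show "tensor_11 A ?V"
      by (simp add: tensor_11_def; simp add: pointwise field_simps)
    show "symmetric_tensor A g\<^sub>2"
      by (rule symmetric_tensor_g)
    show "g\<^sub>2 (?V X) Y - g\<^sub>2 (?V Y) X = (\<lambda>_. 2) * d\<eta> X Y" if "X \<in> VF" "Y \<in> VF" for X Y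
      using that d\<eta>_\<phi>_commute[of X Y] d\<eta>_skew[of X Y]
      by simp (simp add: pointwise algebra_simps)
    show "cov_deriv_02 Dc g\<^sub>2 Z X Y = \<eta> Z * (g\<^sub>2 (?V X + ?P X) Y + g\<^sub>2 X (?V Y + ?P Y))"
      if "X \<in> VF" "Y \<in> VF" "Z \<in> VF" for X Y Z
      using that
      by (simp add: cov_deriv_02_def Dc_d\<eta>_apply Dc_\<phi>_commute Dc_\<eta>)
         (simp add: pointwise algebra_simps)
    show "Dc X (?V Y) = ?V (Dc X Y) + \<eta> X \<odot> ?V' Y" if "X \<in> VF" "Y \<in> VF" for X Y
      using that by (simp add: Dc_\<phi>_commute) (simp add: pointwise algebra_simps)
    show "?V' X + ?V (?V X) + ?P (?V X) - ?V (?P X)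
        = (- (9/4 * (a\<^sup>2 - b\<^sup>2) - 1)) \<cdot> (X - \<eta> X \<odot> \<xi>) - (2) \<cdot> half_lie \<xi> \<phi>\<^sub>2 X" if "X \<in> VF" for X
      using that
      by (simp add: half_lie_\<phi>) (simp add: pointwise field_simps power2_eq_square)
  qed simp_all
qed

lemma kappa_mu_g\<^sub>3: "kappa_mu_condition A \<phi>\<^sub>3 \<xi> \<eta> g\<^sub>3 (1 - 9/4 * b\<^sup>2) (2 - 3 * a)"
proof -
  let ?P = "\<lambda>X. a \<cdot> \<phi>\<^sub>3 X + b \<cdot> \<phi>\<^sub>1 X"
  let ?V = "\<lambda>X. - \<phi>\<^sub>3 X - (3/2 * b) \<cdot> \<phi>\<^sub>1 X"
  let ?V' = "\<lambda>X. (3/2 * a * b) \<cdot> \<phi>\<^sub>2 X - b \<cdot> \<phi>\<^sub>2 X"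
  show ?thesis
  proof (rule kappa_mu_condition_nabla[where V = ?V and V' = ?V'])
    show "tensor_11 A ?V"
      by (simp add: tensor_11_def; simp add: pointwise field_simps)
    show "symmetric_tensor A g\<^sub>3"
      by (rule symmetric_tensor_g)
    show "g\<^sub>3 (?V X) Y - g\<^sub>3 (?V Y) X = (\<lambda>_. 2) * d\<eta> X Y" if "X \<in> VF" "Y \<in> VF" for X Y
      using that d\<eta>_\<phi>_commute[of X Y] d\<eta>_skew[of X Y]
      by simp (simp add: pointwise algebra_simps)
    show "cov_deriv_02 Dc g\<^sub>3 Z X Y = \<eta> Z * (g\<^sub>3 (?V X + ?P X) Y + g\<^sub>3 X (?V Y + ?P Y))"
      if "X \<in> VF" "Y \<in> VF" "Z \<in> VF" for X Y Z
      using that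
      by (simp add: cov_deriv_02_def Dc_d\<eta>_apply Dc_\<phi>_commute Dc_\<eta>)
         (simp add: pointwise algebra_simps)
    show "Dc X (?V Y) = ?V (Dc X Y) + \<eta> X \<odot> ?V' Y" if "X \<in> VF" "Y \<in> VF" for X Y
      using that by (simp add: Dc_\<phi>_commute) (simp add: pointwise algebra_simps)
    show "?V' X + ?V (?V X) + ?P (?V X) - ?V (?P X)
        = (- (1 - 9/4 * b\<^sup>2)) \<cdot> (X - \<eta> X \<odot> \<xi>) - (2 - 3 * a) \<cdot> half_lie \<xi> \<phi>\<^sub>3 X" if "X \<in> VF" for X
      using that
      by (simp add: half_lie_\<phi>) (simp add: pointwise field_simps power2_eq_square)
  qed simp_all
qed

text \<open>If \<open>X\<close> is orthogonal to everything at \<open>p\<close>, then in particular to \<open>\<xi>\<close> and to \<open>\<phi>\<^sub>2 X\<close> (for \<open>g\<^sub>1\<close>) or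
  \<open>\<phi>\<^sub>1 X\<close> (for \<open>g\<^sub>2\<close>). So its projection to \<open>\<D>\<close>, which has the same value at \<open>p\<close>, is null for \<open>g\<^sub>3\<close>.\<close>

lemma paracontact_metric_g:
  assumes pos: "\<And>X p. X \<in> VF \<Longrightarrow> \<eta> X = 0 \<Longrightarrow> value_at p X \<noteq> 0 \<Longrightarrow> g\<^sub>3 X X p > 0"
  shows "paracontact_metric A n \<phi>\<^sub>1 \<xi> \<eta> g\<^sub>1" "paracontact_metric A n \<phi>\<^sub>2 \<xi> \<eta> g\<^sub>2"
proof -
  have rank: "has_rank (eigendistribution A \<phi> r \<inter> contact_distribution A \<eta>) n"
    if "legendre_foliation A n \<eta> (eigendistribution A \<phi> r)" for \<phi> r
    using that by (simp add: legendre_foliation_def Int_absorb2)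
  have nondegenerate: "value_at p X = 0"
    if X: "X \<in> VF" and "\<eta> X p = 0" "d\<eta> X (\<phi>\<^sub>3 X) p = 0" for X p
  proof (rule ccontr)
    let ?X = "X - \<eta> X \<odot> \<xi>"
    assume "value_at p X \<noteq> 0"
    moreover have "value_at p ?X = value_at p X"
      using that by (simp add: value_at_def pointwise)
    ultimately have "g\<^sub>3 ?X ?X p > 0"
      using X by (intro pos) auto
    moreover have "g\<^sub>3 ?X ?X = - d\<eta> X (\<phi>\<^sub>3 X)"
      using X by simp
    ultimately show False
      using that by (simp add: pointwise)
  qed
  have "semi_riemannian_metric A g\<^sub>1"
    unfolding semi_riemannian_metric_def
  proof (intro conjI allI ballI impI symmetric_tensor_g)
    fix p X assume X: "X \<in> VF" and 0: "\<forall>Y\<in>VF. g\<^sub>1 X Y p = 0"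
    show "value_at p X = 0"
    proof (rule nondegenerate[OF X])
      show "\<eta> X p = 0"
        using bspec[OF 0, of \<xi>] X by simp
      show "d\<eta> X (\<phi>\<^sub>3 X) p = 0"
        using bspec[OF 0, of "\<phi>\<^sub>2 X"] X by simp
    qed
  qed
  then show "paracontact_metric A n \<phi>\<^sub>1 \<xi> \<eta> g\<^sub>1"
    unfolding paracontact_metric_def
    using tensor_\<phi> one_form_\<eta> rank leg by auto
  have "semi_riemannian_metric A g\<^sub>2"
    unfolding semi_riemannian_metric_def
  proof (intro conjI allI ballI impI symmetric_tensor_g)
    fix p X assume X: "X \<in> VF" and 0: "\<forall>Y\<in>VF. g\<^sub>2 X Y p = 0"
    show "value_at p X = 0"
    proof (rule nondegenerate[OF X])
      show "\<eta> X p = 0"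
        using bspec[OF 0, of \<xi>] X by simp
      show "d\<eta> X (\<phi>\<^sub>3 X) p = 0"
        using bspec[OF 0, of "\<phi>\<^sub>1 X"] X by (simp add: pointwise)
    qed
  qed
  then show "paracontact_metric A n \<phi>\<^sub>2 \<xi> \<eta> g\<^sub>2"
    unfolding paracontact_metric_def
    using tensor_\<phi> one_form_\<eta> rank leg by auto
qed

text \<open>Only a field \<open>X\<close> that vanishes at \<open>p\<close> is at issue. That \<open>g\<^sub>3 X X p\<close> depends on the value of \<open>X\<close>
  at \<open>p\<close> alone would require local frames, but definiteness gives the inequality directly: if \<open>Z\<close> in
  \<open>\<D>\<close> does not vanish at \<open>p\<close>, then neither does \<open>t X + Z\<close>, so the quadratic polynomial
  \<open>g\<^sub>3 (t X + Z) (t X + Z) p\<close> is positive for all \<open>t\<close> and its leading coefficient cannot be negative.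
  If all of \<open>\<D>\<close> vanishes at \<open>p\<close>, then so does \<open>[X, \<phi>\<^sub>3 X]\<close>, as well as its component in \<open>\<D>\<close>, and
  hence its component along \<open>\<xi>\<close>.\<close>

lemma g\<^sub>3_nonneg:
  assumes pos: "\<And>X p. X \<in> VF \<Longrightarrow> \<eta> X = 0 \<Longrightarrow> value_at p X \<noteq> 0 \<Longrightarrow> g\<^sub>3 X X p > 0"
    and X: "X \<in> VF" "\<eta> X = 0" and \<xi>: "value_at p \<xi> \<noteq> 0"
  shows "g\<^sub>3 X X p \<ge> 0"
proof (cases "\<exists>Z\<in>VF. \<eta> Z = 0 \<and> value_at p Z \<noteq> 0")
  case True
  then obtain Z where Z: "Z \<in> VF" "\<eta> Z = 0" "value_at p Z \<noteq> 0"
    by blast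
  show ?thesis
  proof (cases "value_at p X = 0")
    case False
    then show ?thesis
      using pos[OF X] by (simp add: less_imp_le)
  next
    case X0: True
    have quad: "g\<^sub>3 X X p * t\<^sup>2 + 2 * g\<^sub>3 X Z p * t + g\<^sub>3 Z Z p > 0" for t
    proof -
      have "value_at p (t \<cdot> X + Z) = value_at p Z"
        using X0 by (simp add: value_at_def pointwise)
      then have "g\<^sub>3 (t \<cdot> X + Z) (t \<cdot> X + Z) p > 0"
        using X Z by (intro pos) auto
      then show ?thesis
        using X Z d\<eta>_\<phi>_commute(3)[of X Z]
        by simp (simp add: pointwise algebra_simps power2_eq_square)
    qed
    define q s where "q = g\<^sub>3 X X p" and "s = g\<^sub>3 Z Z p"
    \<comment> \<open>averaging over \<open>t\<close> and \<open>- t\<close> removes the linear term\<close>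
    have even: "q * t\<^sup>2 + s > 0" for t
      using quad[of t] quad[of "- t"] by (simp add: q_def s_def)
    show ?thesis
    proof (rule ccontr)
      assume "\<not> g\<^sub>3 X X p \<ge> 0"
      then have "q < 0"
        by (simp add: q_def)
      moreover have "s > 0"
        using even[of 0] by simp
      ultimately show False
        using even[of "sqrt (s / - q)"] by (simp add: divide_nonneg_neg)
    qed
  qed
next
  case False
  then have vanish: "Z f p = 0" if "Z \<in> VF" "\<eta> Z = 0" for Z f
    using that by (metis value_at_def zero_fun_apply)
  let ?B = "lie_bracket X (\<phi>\<^sub>3 X)"
  have "(?B - \<eta> ?B \<odot> \<xi>) f p = 0" for f
    using X by (intro vanish) auto
  moreover have "?B f p = 0" for f
    using X vanish[of X] vanish[of "\<phi>\<^sub>3 X"] by (simp add: lie_bracket_def pointwise)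
  ultimately have "\<eta> ?B p * \<xi> f p = 0" for f
    by (simp add: pointwise)
  with \<xi> have "\<eta> ?B p = 0"
    by (auto simp: value_at_def pointwise)
  with X show ?thesis
    by (simp add: d\<eta>_contact_distribution) (simp add: pointwise)
qed

text \<open>A field that does not vanish at \<open>p\<close> may still be a multiple of \<open>\<xi>\<close> there; the contribution
  of its projection to \<open>\<D>\<close> is then bounded by \<open>g\<^sub>3_nonneg\<close>.\<close>

lemma contact_metric_g:
  assumes pos: "\<And>X p. X \<in> VF \<Longrightarrow> \<eta> X = 0 \<Longrightarrow> value_at p X \<noteq> 0 \<Longrightarrow> g\<^sub>3 X X p > 0"
  shows "contact_metric A \<phi>\<^sub>3 \<xi> \<eta> g\<^sub>3"
proof -
  have "g\<^sub>3 X X p > 0" if X: "X \<in> VF" and "value_at p X \<noteq> 0" for X p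
  proof -
    let ?X = "X - \<eta> X \<odot> \<xi>"
    have split: "g\<^sub>3 X X p = g\<^sub>3 ?X ?X p + (\<eta> X p)\<^sup>2"
      using X by simp (simp add: pointwise power2_eq_square)
    show ?thesis
    proof (cases "value_at p ?X = 0")
      case False
      then have "g\<^sub>3 ?X ?X p > 0"
        using X by (intro pos) auto
      with split show ?thesis
        by (simp add: add_pos_nonneg)
    next
      case True
      then have eq: "value_at p X = (\<lambda>f. \<eta> X p * \<xi> f p)"
        by (simp add: value_at_def pointwise)
      with that have "\<eta> X p \<noteq> 0" "value_at p \<xi> \<noteq> 0"
        by (auto simp: value_at_def pointwise)
      moreover from this have "g\<^sub>3 ?X ?X p \<ge> 0"
        using X by (intro g\<^sub>3_nonneg pos) auto
      ultimately have "g\<^sub>3 ?X ?X p \<ge> 0" "(\<eta> X p)\<^sup>2 > 0"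
        by auto
      with split show ?thesis
        by linarith
    qed
  qed
  then have "riemannian_metric A g\<^sub>3"
    using symmetric_tensor_g by (simp add: riemannian_metric_def positive_definite_on_def)
  then show ?thesis
    unfolding contact_metric_def
    using tensor_\<phi> one_form_\<eta> by auto
qed

end

theorem theorem5p13:
  fixes A :: "('a::{t2_space,second_countable_topology}, 'e::euclidean_space) atlas"
    and n :: nat
    and \<eta> :: "'a vfield \<Rightarrow> 'a \<Rightarrow> real"
    and \<xi> :: "'a vfield"
    and \<phi>\<^sub>1 \<phi>\<^sub>2 \<phi>\<^sub>3 :: "'a vfield \<Rightarrow> 'a vfield"
    and Dc :: "'a vfield \<Rightarrow> 'a vfield \<Rightarrow> 'a vfield"
    and g\<^sub>1 g\<^sub>2 g\<^sub>3 \<pi>\<^sub>1 :: "'a vfield \<Rightarrow> 'a vfield \<Rightarrow> 'a \<Rightarrow> real"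
    and a b :: real
  assumes "contact_manifold A n \<eta>"
    and "reeb_field A \<eta> \<xi>"
    and "integrable_almost_bi_paracontact A n \<eta> \<xi> \<phi>\<^sub>1 \<phi>\<^sub>2 \<phi>\<^sub>3"
    and "canonical_connection A \<eta> \<xi> \<phi>\<^sub>1 \<phi>\<^sub>2 \<phi>\<^sub>3 Dc"
    and "\<forall>X\<in>vector_fields A. \<forall>Y\<in>vector_fields A. \<forall>Z\<in>vector_fields A.
      cov_deriv_02 Dc (ext_deriv \<eta>) X Y Z = 0"
    and "cov_deriv_eq A \<eta> Dc \<phi>\<^sub>1 (\<lambda>Y. (- a) \<cdot> \<phi>\<^sub>2 Y)"
    and "cov_deriv_eq A \<eta> Dc \<phi>\<^sub>2 (\<lambda>Y. a \<cdot> \<phi>\<^sub>1 Y + b \<cdot> \<phi>\<^sub>3 Y)"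
    and "cov_deriv_eq A \<eta> Dc \<phi>\<^sub>3 (\<lambda>Y. b \<cdot> \<phi>\<^sub>2 Y)"
    and "b > 0"
    and "g\<^sub>1 = (\<lambda>X Y. ext_deriv \<eta> X (\<phi>\<^sub>1 Y) + \<eta> X * \<eta> Y)"
    and "g\<^sub>2 = (\<lambda>X Y. ext_deriv \<eta> X (\<phi>\<^sub>2 Y) + \<eta> X * \<eta> Y)"
    and "g\<^sub>3 = (\<lambda>X Y. - ext_deriv \<eta> X (\<phi>\<^sub>3 Y) + \<eta> X * \<eta> Y)"
    and "\<pi>\<^sub>1 = (\<lambda>X Y. g\<^sub>1 (half_lie \<xi> \<phi>\<^sub>1 X) Y)"
    and "(a > 0 \<and> positive_definite_on (contact_distribution A \<eta>) \<pi>\<^sub>1) \<or>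
         (a < 0 \<and> negative_definite_on (contact_distribution A \<eta>) \<pi>\<^sub>1)"
  shows "paracontact_metric_kappa_mu A n \<phi>\<^sub>1 \<xi> \<eta> g\<^sub>1 (9/4 * a\<^sup>2 - 1) (2 - 3 * b) \<and>
    paracontact_metric_kappa_mu A n \<phi>\<^sub>2 \<xi> \<eta> g\<^sub>2 (9/4 * (a\<^sup>2 - b\<^sup>2) - 1) 2 \<and>
    contact_metric_kappa_mu A \<phi>\<^sub>3 \<xi> \<eta> g\<^sub>3 (1 - 9/4 * b\<^sup>2) (2 - 3 * a) \<and>
    standard_almost_bi_paracontact A \<phi>\<^sub>3 \<xi> \<eta> g\<^sub>3 (1 - 9/4 * b\<^sup>2) (2 - 3 * a) \<phi>\<^sub>1 \<phi>\<^sub>2 \<phi>\<^sub>3"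
proof -
  interpret canonical_bi_paracontact A \<eta> \<xi> n \<phi>\<^sub>1 \<phi>\<^sub>2 \<phi>\<^sub>3 Dc a b
    using assms(1-8) by unfold_locales (auto simp: contact_manifold_def)
  have \<pi>\<^sub>1: "\<pi>\<^sub>1 X X p = 3/2 * a * g\<^sub>3 X X p" if "X \<in> VF" "\<eta> X = 0" for X p
    using that unfolding assms(10,12,13)
    by (simp add: half_lie_\<phi>) (simp add: pointwise)
  have pos: "- ext_deriv \<eta> X (\<phi>\<^sub>3 X) p > 0" if "X \<in> VF" "\<eta> X = 0" "value_at p X \<noteq> 0" for X p
  proof -
    have "a > 0 \<and> \<pi>\<^sub>1 X X p > 0 \<or> a < 0 \<and> \<pi>\<^sub>1 X X p < 0"
      using assms(14) that
      by (auto simp: positive_definite_on_def negative_definite_on_def contact_distribution_def)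
    then have "g\<^sub>3 X X p > 0"
      using \<pi>\<^sub>1[OF that(1,2)] by (auto simp: zero_less_mult_iff mult_less_0_iff)
    with that show ?thesis
      by (simp add: assms(12) pointwise)
  qed
  have contact: "contact_metric_kappa_mu A \<phi>\<^sub>3 \<xi> \<eta> g\<^sub>3 (1 - 9/4 * b\<^sup>2) (2 - 3 * a)"
    unfolding contact_metric_kappa_mu_def assms(12)
    using pos by (intro conjI contact_metric_g kappa_mu_g\<^sub>3) (simp add: pointwise)
  have "sqrt (1 - (1 - 9/4 * b\<^sup>2)) = 3/2 * b"
    using \<open>b > 0\<close> by (intro real_sqrt_unique) (auto simp: power2_eq_square)
  then have "standard_almost_bi_paracontact A \<phi>\<^sub>3 \<xi> \<eta> g\<^sub>3 (1 - 9/4 * b\<^sup>2) (2 - 3 * a) \<phi>\<^sub>1 \<phi>\<^sub>2 \<phi>\<^sub>3"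
    unfolding standard_almost_bi_paracontact_def
    using contact \<open>b > 0\<close> by (simp add: half_lie_\<phi>) (simp add: pointwise)
  moreover have "paracontact_metric_kappa_mu A n \<phi>\<^sub>1 \<xi> \<eta> g\<^sub>1 (9/4 * a\<^sup>2 - 1) (2 - 3 * b)"
    unfolding paracontact_metric_kappa_mu_def assms(10)
    using pos by (intro conjI paracontact_metric_g kappa_mu_g\<^sub>1) (simp add: pointwise)
  moreover have "paracontact_metric_kappa_mu A n \<phi>\<^sub>2 \<xi> \<eta> g\<^sub>2 (9/4 * (a\<^sup>2 - b\<^sup>2) - 1) 2"
    unfolding paracontact_metric_kappa_mu_def assms(11)
    using pos by (intro conjI paracontact_metric_g kappa_mu_g\<^sub>2) (simp add: pointwise)
  ultimately show ?thesis
    using contact by blast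
qed

end
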